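(* Let $\mathbb K\in\{\mathbb R,\mathbb C\}$, let $p\geq 1$ be an integer, and let $K(z,w)$ be a $\mathbb K^{p\times p}$-valued function of $z,w\in\mathbb K$, entire in $z$ and $\overline w$. Then: (1) For every pair $(z,w)\in\mathbb K^2$, the semi-infinite block matrix $$\mathscr K_{n,m}(z,w)=\frac1{m!\,n!}\frac{\partial^{n+m}K(z,w)}{\partial z^n\partial\overline w^m},\qquad n,m=0,1,\ldots$$ defines a bounded operator, denoted by $\mathscr K(z,w)$, from $\ell_2(\mathbb N_0,\mathbb K^p)$ into itself. (2) The operator $\mathscr K(w,w)$ is Hermitian if the kernel $K(z,w)$ is Hermitian. (3) The $\mathbf B(\ell_2(\mathbb N_0,\mathbb K^p))$-valued function $\mathscr K(z,w)$ is positive definite in $\mathbb K$ if the kernel $K(z,w)$ is positive definite in $\mathbb K$. (4) Assume the kernel $K(z,w)$ is positive definite in $\mathbb K$. Then, for all $z,w\in\mathbb K$, $\mathscr K(z,w)=J_zJ_w^*$.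
   Context: $\ell_2(\mathbb N_0,\mathbb K^p)$ is the Hilbert space of sequences $(\xi_n)_{n=0}^\infty$ in $\mathbb K^p$ with $\sum_n\|\xi_n\|^2<\infty$, written as semi-infinite column vectors. "Entire in $z$ and $\overline w$" means that $K(z,w)$ is given by a power series in $z$ and $\overline w$ converging on all of $\mathbb K^2$ (for $\mathbb K=\mathbb R$, $\overline w=w$). The kernel $K$ is Hermitian if $K(z,w)^*=K(w,z)$ for all $z,w$. An operator- (or matrix-) valued kernel $L(z,w)$ acting on a Hilbert space $\mathcal E$ is positive definite in $\mathbb K$ if $((z,f),(w,e))\mapsto\langle L(z,w)e,f\rangle_{\mathcal E}$ is a (Hermitian) positive semidefinite scalar kernel on $\mathbb K\times\mathcal E$. When $K$ is positive definite, $\mathcal H(K)$ denotes the reproducing kernel Hilbert space of $\mathbb K^p$-valued functions on $\mathbb K$ with reproducing kernel $K$; its elements are entire. For $z\in\mathbb K$, $J_z:\mathcal H(K)\to\ell_2(\mathbb N_0,\mathbb K^p)$ is the (bounded) operator $$J_z(f)=\Big(\frac{f^{(n)}(z)}{n!}\Big)_{n=0}^\infty .$$ *)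

theory Defs
  imports "HOL-Analysis.Analysis"
begin

text \<open>
  The scalar field: a normed field carrying a conjugation with
  \<open>x * cj x = |x|^2\<close>.  Up to isomorphism the only instances are the real numbers (with trivial
  conjugation) and the complex numbers; see the lemma \<open>rc_field_dichotomy\<close>.
\<close>

class rc_field = real_normed_field + euclidean_space +
  fixes cj :: "'a \<Rightarrow> 'a"
  assumes cj_add: "cj (x + y) = cj x + cj y"
    and cj_mult: "cj (x * y) = cj x * cj y"
    and cj_scaleR_1: "cj (r *\<^sub>R 1) = r *\<^sub>R 1"
    and mult_cj_scaleR_1: "x * cj x = (norm x)\<^sup>2 *\<^sub>R 1"

lemma cj_of_real: "cj (of_real r) = (of_real r :: 'k::rc_field)"
  by (simp add: of_real_def cj_scaleR_1)

lemma mult_cj: "x * cj x = (of_real ((norm x)\<^sup>2) :: 'k::rc_field)"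
  by (simp add: of_real_def mult_cj_scaleR_1)

instantiation real :: rc_field
begin
definition cj_real :: "real \<Rightarrow> real" where "cj_real x = x"
instance by standard (auto simp: cj_real_def power2_eq_square)
end

instantiation complex :: rc_field
begin
definition cj_complex :: "complex \<Rightarrow> complex" where "cj_complex = cnj"
instance by standard (auto simp: cj_complex_def scaleR_conv_of_real simp flip: complex_norm_square)
end

lemma rc_field_real_part:
  fixes x :: "'k::rc_field"
  shows "\<exists>r. x + cj x = of_real r"
proof -
  have "(x + 1) * cj (x + 1) = x * cj x + (x + cj x) + 1"
    using cj_of_real[of 1, where 'k='k] by (simp add: cj_add algebra_simps)
  then have "x + cj x = of_real ((norm (x + 1))\<^sup>2) - of_real ((norm x)\<^sup>2) - 1"
    by (simp only: mult_cj) (simp add: algebra_simps)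
  also have "\<dots> = of_real ((norm (x + 1))\<^sup>2 - (norm x)\<^sup>2 - 1)"
    by simp
  finally show ?thesis by blast
qed

lemma rc_field_dichotomy:
  "((\<forall>x::'k::rc_field. x \<in> \<real> \<and> cj x = x)) \<or>
   (\<exists>j::'k. j * j = -1 \<and> cj j = - j \<and> (\<forall>x. \<exists>a b. x = of_real a + of_real b * j))"
proof (cases "\<forall>x::'k. x \<in> \<real>")
  case True
  then show ?thesis by (metis Reals_cases cj_of_real)
next
  case False
  have dec: "\<exists>a y. x = of_real a + y \<and> cj y = - y" for x :: 'k
  proof -
    obtain r where r: "x + cj x = of_real r" using rc_field_real_part by blast
    have "cj (x - of_real (r/2)) = cj x - of_real (r/2)"
      using cj_add[of "x" "of_real (- (r/2))"] cj_of_real[of "- (r/2)", where 'k='k] by simp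
    also have "\<dots> = - (x - of_real (r/2))"
      using r by (simp add: algebra_simps eq_diff_eq flip: r)
    finally show ?thesis
      by (intro exI[of _ "r/2"] exI[of _ "x - of_real (r/2)"]) simp
  qed
  from False obtain x :: 'k where x: "x \<notin> \<real>" by blast
  obtain a y where y: "x = of_real a + y" "cj y = - y" using dec by blast
  with x have y0: "y \<noteq> 0" by auto
  define i where "i = y / of_real (norm y)"
  have yy: "y * y = - of_real ((norm y)\<^sup>2)" using mult_cj[of y] y(2)
    by (metis minus_mult_right minus_minus)
  have cji: "cj i = - i"
  proof -
    have "i = y * of_real (1 / norm y)" by (simp add: i_def divide_inverse)
    then show ?thesis using y(2) by (simp only: cj_mult cj_of_real) simp
  qed
  have ii: "i * i = -1"
    using yy y0 by (simp add: i_def power2_eq_square)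
  have "\<exists>a b. u = of_real a + of_real b * i" for u
  proof -
    obtain a v where v: "u = of_real a + v" "cj v = - v" using dec by blast
    have c: "cj (v * i) = v * i" using v(2) cji by (simp add: cj_mult)
    obtain r where "v * i + cj (v * i) = of_real r" using rc_field_real_part by blast
    then have vi: "v * i = of_real (r/2)" unfolding c by (simp flip: mult_2 add: field_simps)
    have "v = - (v * i) * i" using ii by (simp add: mult.assoc)
    then have "v = of_real (- r/2) * i" unfolding vi by simp
    then show ?thesis using v(1) by blast
  qed
  with ii cji show ?thesis by blast
qed

text \<open>
  The library has no inner product spaces over the complex numbers.  A space is given by a
  carrier \<open>H\<close>, a set of functions into \<open>'k ^ 'p\<close> with pointwise operations, and
  an inner product \<open>ip\<close>, linear in its first argument, whose values outside \<open>H\<close>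
  are irrelevant.
\<close>

definition vinner :: "'k::rc_field ^ 'p \<Rightarrow> 'k ^ 'p \<Rightarrow> 'k" where
  "vinner x y = (\<Sum>i\<in>UNIV. x $ i * cj (y $ i))"

definition ip_norm :: "('v \<Rightarrow> 'v \<Rightarrow> 'k::rc_field) \<Rightarrow> 'v \<Rightarrow> real" where
  "ip_norm ip f = sqrt (norm (ip f f))"

definition function_subspace :: "('x \<Rightarrow> 'k::rc_field ^ 'p) set \<Rightarrow> bool" where
  "function_subspace H \<longleftrightarrow>
     (\<lambda>x. 0) \<in> H \<and>
     (\<forall>f\<in>H. \<forall>g\<in>H. (\<lambda>x. f x + g x) \<in> H) \<and>
     (\<forall>f\<in>H. \<forall>c. (\<lambda>x. c *s f x) \<in> H)"

definition inner_product_on ::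
  "('x \<Rightarrow> 'k::rc_field ^ 'p) set \<Rightarrow> (('x \<Rightarrow> 'k ^ 'p) \<Rightarrow> ('x \<Rightarrow> 'k ^ 'p) \<Rightarrow> 'k) \<Rightarrow> bool" where
  "inner_product_on H ip \<longleftrightarrow>
     (\<forall>f\<in>H. \<forall>g\<in>H. \<forall>h\<in>H. ip (\<lambda>x. f x + g x) h = ip f h + ip g h) \<and>
     (\<forall>f\<in>H. \<forall>h\<in>H. \<forall>c. ip (\<lambda>x. c *s f x) h = c * ip f h) \<and>
     (\<forall>f\<in>H. \<forall>g\<in>H. ip g f = cj (ip f g)) \<and>
     (\<forall>f\<in>H. ip f f \<in> \<real>\<^sub>\<ge>\<^sub>0) \<and>
     (\<forall>f\<in>H. ip f f = 0 \<longrightarrow> f = (\<lambda>x. 0))"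

definition hilbert_space_on ::
  "('x \<Rightarrow> 'k::rc_field ^ 'p) set \<Rightarrow> (('x \<Rightarrow> 'k ^ 'p) \<Rightarrow> ('x \<Rightarrow> 'k ^ 'p) \<Rightarrow> 'k) \<Rightarrow> bool" where
  "hilbert_space_on H ip \<longleftrightarrow>
     function_subspace H \<and> inner_product_on H ip \<and>
     (\<forall>F :: nat \<Rightarrow> 'x \<Rightarrow> 'k ^ 'p.
        range F \<subseteq> H \<longrightarrow>
        (\<forall>\<epsilon>>0. \<exists>N. \<forall>m\<ge>N. \<forall>n\<ge>N. ip_norm ip (\<lambda>x. F m x - F n x) < \<epsilon>) \<longrightarrow>
        (\<exists>f\<in>H. (\<lambda>n. ip_norm ip (\<lambda>x. F n x - f x)) \<longlonglongrightarrow> 0))"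

definition bounded_operator_on ::
  "('x \<Rightarrow> 'k::rc_field ^ 'p) set \<Rightarrow> (('x \<Rightarrow> 'k ^ 'p) \<Rightarrow> ('x \<Rightarrow> 'k ^ 'p) \<Rightarrow> 'k) \<Rightarrow>
   ('y \<Rightarrow> 'k ^ 'q) set \<Rightarrow> (('y \<Rightarrow> 'k ^ 'q) \<Rightarrow> ('y \<Rightarrow> 'k ^ 'q) \<Rightarrow> 'k) \<Rightarrow>
   (('x \<Rightarrow> 'k ^ 'p) \<Rightarrow> ('y \<Rightarrow> 'k ^ 'q)) \<Rightarrow> bool" where
  "bounded_operator_on H ip H' ip' T \<longleftrightarrow>
     (\<forall>f\<in>H. T f \<in> H') \<and>
     (\<forall>f\<in>H. \<forall>g\<in>H. T (\<lambda>x. f x + g x) = (\<lambda>y. T f y + T g y)) \<and>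
     (\<forall>f\<in>H. \<forall>c. T (\<lambda>x. c *s f x) = (\<lambda>y. c *s T f y)) \<and>
     (\<exists>C. \<forall>f\<in>H. ip_norm ip' (T f) \<le> C * ip_norm ip f)"

definition adjoint_on ::
  "('x \<Rightarrow> 'k::rc_field ^ 'p) set \<Rightarrow> (('x \<Rightarrow> 'k ^ 'p) \<Rightarrow> ('x \<Rightarrow> 'k ^ 'p) \<Rightarrow> 'k) \<Rightarrow>
   (('y \<Rightarrow> 'k ^ 'q) \<Rightarrow> ('y \<Rightarrow> 'k ^ 'q) \<Rightarrow> 'k) \<Rightarrow>
   (('x \<Rightarrow> 'k ^ 'p) \<Rightarrow> ('y \<Rightarrow> 'k ^ 'q)) \<Rightarrow> ('y \<Rightarrow> 'k ^ 'q) \<Rightarrow> ('x \<Rightarrow> 'k ^ 'p)" where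
  "adjoint_on H ip ip' T h = (THE g. g \<in> H \<and> (\<forall>f\<in>H. ip' (T f) h = ip f g))"

definition hermitian_operator_on ::
  "'v set \<Rightarrow> ('v \<Rightarrow> 'v \<Rightarrow> 'k::rc_field) \<Rightarrow> ('v \<Rightarrow> 'v) \<Rightarrow> bool" where
  "hermitian_operator_on H ip T \<longleftrightarrow> (\<forall>f\<in>H. \<forall>g\<in>H. ip (T f) g = ip f (T g))"

definition ell2 :: "(nat \<Rightarrow> 'k::rc_field ^ 'p) set" where
  "ell2 = {\<xi>. summable (\<lambda>n. (norm (\<xi> n))\<^sup>2)}"

definition ell2_inner :: "(nat \<Rightarrow> 'k::rc_field ^ 'p) \<Rightarrow> (nat \<Rightarrow> 'k ^ 'p) \<Rightarrow> 'k" where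
  "ell2_inner \<xi> \<eta> = (\<Sum>n. vinner (\<xi> n) (\<eta> n))"

definition block_op ::
  "(nat \<Rightarrow> nat \<Rightarrow> 'k::rc_field ^ 'p ^ 'p) \<Rightarrow> (nat \<Rightarrow> 'k ^ 'p) \<Rightarrow> (nat \<Rightarrow> 'k ^ 'p)" where
  "block_op M \<xi> = (\<lambda>n. \<Sum>m. M n m *v \<xi> m)"

text \<open>The first conjunct excludes the junk values of \<open>suminf\<close> in \<open>block_op\<close>.\<close>

definition defines_bounded_operator ::
  "(nat \<Rightarrow> nat \<Rightarrow> 'k::rc_field ^ 'p ^ 'p) \<Rightarrow> bool" where
  "defines_bounded_operator M \<longleftrightarrow>
     (\<forall>\<xi>\<in>ell2. \<forall>n. summable (\<lambda>m. M n m *v \<xi> m)) \<and>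
     bounded_operator_on ell2 ell2_inner ell2 ell2_inner (block_op M)"

definition psd_scalar_kernel :: "'x set \<Rightarrow> ('x \<Rightarrow> 'x \<Rightarrow> 'k::rc_field) \<Rightarrow> bool" where
  "psd_scalar_kernel X k \<longleftrightarrow>
     (\<forall>x\<in>X. \<forall>y\<in>X. k y x = cj (k x y)) \<and>
     (\<forall>S c. finite S \<longrightarrow> S \<subseteq> X \<longrightarrow> (\<Sum>x\<in>S. \<Sum>y\<in>S. cj (c x) * k x y * c y) \<in> \<real>\<^sub>\<ge>\<^sub>0)"

definition positive_definite_kernel ::
  "'e set \<Rightarrow> ('e \<Rightarrow> 'e \<Rightarrow> 'k) \<Rightarrow> ('k::rc_field \<Rightarrow> 'k \<Rightarrow> 'e \<Rightarrow> 'e) \<Rightarrow> bool" where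
  "positive_definite_kernel E ip L \<longleftrightarrow>
     psd_scalar_kernel (UNIV \<times> E) (\<lambda>(z, f) (w, e). ip (L z w e) f)"

definition positive_definite_matrix_kernel ::
  "('k::rc_field \<Rightarrow> 'k \<Rightarrow> 'k ^ 'p ^ 'p) \<Rightarrow> bool" where
  "positive_definite_matrix_kernel K \<longleftrightarrow>
     positive_definite_kernel UNIV vinner (\<lambda>z w e. K z w *v e)"

definition conj_transpose :: "'k::rc_field ^ 'p ^ 'q \<Rightarrow> 'k ^ 'q ^ 'p" where
  "conj_transpose A = (\<chi> i j. cj (A $ j $ i))"

definition hermitian_kernel :: "('k::rc_field \<Rightarrow> 'k \<Rightarrow> 'k ^ 'p ^ 'p) \<Rightarrow> bool" where
  "hermitian_kernel K \<longleftrightarrow> (\<forall>z w. conj_transpose (K z w) = K w z)"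

text \<open>
  A power series in two variables converging at every point converges absolutely, so unordered
  summation is no restriction.
\<close>

definition entire_kernel :: "('k::rc_field \<Rightarrow> 'k \<Rightarrow> 'k ^ 'p ^ 'p) \<Rightarrow> bool" where
  "entire_kernel K \<longleftrightarrow>
     (\<exists>A :: nat \<Rightarrow> nat \<Rightarrow> 'k ^ 'p ^ 'p. \<forall>z w i j.
        ((\<lambda>(n, m). A n m $ i $ j * z ^ n * cj w ^ m) has_sum K z w $ i $ j) UNIV)"

text \<open>
  The derivative of \<open>g\<close> with respect to the conjugate variable, for \<open>g\<close> a
  differentiable function of \<open>cj w\<close>: differentiate in that variable.  Over the complex
  numbers it is the Wirtinger derivative, over the real numbers the ordinary one.
\<close>

definition deriv_cj :: "('k::rc_field \<Rightarrow> 'k) \<Rightarrow> 'k \<Rightarrow> 'k" where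
  "deriv_cj g w = deriv (\<lambda>u. g (cj u)) (cj w)"

lemma deriv_cj_real: "deriv_cj g (x::real) = deriv g x"
  by (simp add: deriv_cj_def cj_real_def)

lemma deriv_cj_wirtinger:
  assumes "(h has_field_derivative d) (at (cnj w))"
  shows "\<exists>D. ((\<lambda>u. h (cnj u)) has_derivative D) (at w) \<and>
             deriv_cj (\<lambda>u. h (cnj u)) w = (D 1 + \<i> * D \<i>) / 2"
proof (intro exI conjI)
  have "(h has_derivative (*) d) (at (cnj w))"
    using assms by (simp add: has_field_derivative_def)
  then show "((\<lambda>u. h (cnj u)) has_derivative (\<lambda>v. d * cnj v)) (at w)"
    by (rule has_derivative_compose[rotated]) (intro derivative_eq_intros | simp)+
  show "deriv_cj (\<lambda>u. h (cnj u)) w = (d * cnj 1 + \<i> * (d * cnj \<i>)) / 2"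
    using assms by (simp add: deriv_cj_def cj_complex_def DERIV_imp_deriv mult.left_commute[of \<i> d])
qed

definition taylor_block ::
  "('k::rc_field \<Rightarrow> 'k \<Rightarrow> 'k ^ 'p ^ 'p) \<Rightarrow> 'k \<Rightarrow> 'k \<Rightarrow> nat \<Rightarrow> nat \<Rightarrow> 'k ^ 'p ^ 'p" where
  "taylor_block K z w n m =
     (\<chi> i j. (deriv ^^ n) (\<lambda>z'. (deriv_cj ^^ m) (\<lambda>w'. K z' w' $ i $ j) w) z / (fact m * fact n))"

definition taylor_op ::
  "('k::rc_field \<Rightarrow> 'k \<Rightarrow> 'k ^ 'p ^ 'p) \<Rightarrow> 'k \<Rightarrow> 'k \<Rightarrow> (nat \<Rightarrow> 'k ^ 'p) \<Rightarrow> (nat \<Rightarrow> 'k ^ 'p)" where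
  "taylor_op K z w = block_op (taylor_block K z w)"

text \<open>
  For positive definite \<open>K\<close> exactly one \<open>H\<close> satisfies \<open>is_rkhs K H ip\<close>, and
  \<open>ip\<close> is unique up to its values off \<open>H\<close> (Moore--Aronszajn).
\<close>

definition is_rkhs ::
  "('k::rc_field \<Rightarrow> 'k \<Rightarrow> 'k ^ 'p ^ 'p) \<Rightarrow> ('k \<Rightarrow> 'k ^ 'p) set \<Rightarrow>
   (('k \<Rightarrow> 'k ^ 'p) \<Rightarrow> ('k \<Rightarrow> 'k ^ 'p) \<Rightarrow> 'k) \<Rightarrow> bool" where
  "is_rkhs K H ip \<longleftrightarrow>
     hilbert_space_on H ip \<and>
     (\<forall>w e. (\<lambda>z. K z w *v e) \<in> H \<and>
            (\<forall>f\<in>H. ip f (\<lambda>z. K z w *v e) = vinner (f w) e))"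

definition taylor_map :: "'k::rc_field \<Rightarrow> ('k \<Rightarrow> 'k ^ 'p) \<Rightarrow> (nat \<Rightarrow> 'k ^ 'p)" where
  "taylor_map z f = (\<lambda>n. \<chi> i. (deriv ^^ n) (\<lambda>u. f u $ i) z / fact n)"

end

theory Submission imports Defs begin

text \<open>
Write \<open>K z w = (\<Sum>n m. z ^ n * A n m * cj w ^ m)\<close>.  Everything about the operators of the
theorem is reduced to the single infinite matrix \<open>A\<close>, whose entries decay faster than every
geometric sequence because the double series converges everywhere.

Expanding a power series around \<open>z\<close> instead of \<open>0\<close> is a linear map \<open>S z\<close> on coefficient sequences
(\<open>taylor_shift\<close>).  Its adjoint \<open>T z\<close> (\<open>cotaylor\<close>) sends bounded sequences to sequences of at most
geometric growth, so that \<open>A\<close> can be applied to its values.  Interchanging sums gives the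
factorisation \<open>taylor_op K z w = S z \<circ> A \<circ> T w\<close> (\<open>taylor_op_factor\<close>).  The decay of \<open>A\<close> makes
this a bounded operator, and moving \<open>S z\<close> to the other side gives
\<open>\<langle>taylor_op K z w \<xi>, \<eta>\<rangle> = \<langle>A (T w \<xi>), T z \<eta>\<rangle>\<close> (\<open>taylor_op_inner\<close>).  Symmetry and positivity of
the Taylor operators therefore follow from symmetry and positivity of the sesquilinear form
\<open>form \<Xi> \<Theta> = \<langle>A \<Xi>, \<Theta>\<rangle>\<close> on sequences of geometric growth.

On the evaluation sequences \<open>\<lambda>m. cj h ^ m *s e\<close> the form takes the values
\<open>\<langle>K h' h e, e'\<rangle>\<close>, so on their linear combinations it inherits symmetry and positivity from the kernel.
These combinations are dense for convergence in weighted sup norms (\<open>approximable_growth\<close>): the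
unit sequence at position \<open>n\<close> is the limit, as \<open>h\<close> tends to \<open>0\<close>, of the evaluation sequence at \<open>h\<close>
with its first \<open>n\<close> terms removed, divided by \<open>h ^ n\<close>.  The form is continuous for this convergence,
so symmetry and positivity extend to all sequences of geometric growth.

The same density gives the reproducing kernel Hilbert space.  The function
\<open>kernel_series \<Xi> = (\<lambda>z. \<Sum>n. z ^ n *s (A \<Xi>) n)\<close> is a combination of kernel functions when \<open>\<Xi>\<close> is a
combination of evaluation sequences, and there its norm is given by the form.  By completeness it lies
in \<open>H\<close> for every \<open>\<Xi>\<close> of geometric growth (\<open>kernel_series_limit\<close>).  Pairing \<open>f\<close> with the functions of
the unit sequences yields the power series coefficients of \<open>f\<close>, hence \<open>f\<close> is entire and its Taylor
map is \<open>S z\<close> applied to them.  The adjoint of the Taylor map at \<open>w\<close> is \<open>\<xi> \<mapsto> kernel_series (T w \<xi>)\<close>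
(\<open>adjoint_taylor_map\<close>), whose coefficients are \<open>A (T w \<xi>)\<close>; composing with the Taylor map at \<open>z\<close>
recovers \<open>S z \<circ> A \<circ> T w\<close>.
\<close>

section \<open>Conjugation, the inner product and geometric bounds\<close>

lemma cj_0 [simp]: "cj 0 = (0::'k::rc_field)"
  using cj_of_real[of 0, where 'k='k] by simp

lemma cj_1 [simp]: "cj 1 = (1::'k::rc_field)"
  using cj_of_real[of 1, where 'k='k] by simp

lemma cj_eq_0_iff [simp]: "cj x = 0 \<longleftrightarrow> x = (0::'k::rc_field)"
  using mult_cj[of x] by (metis cj_0 mult_zero_right norm_eq_zero of_real_eq_0_iff zero_eq_power2)

lemma norm_cj [simp]: "norm (cj x) = norm (x::'k::rc_field)"
proof (cases "x = 0")
  case False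
  have "norm (x * cj x) = norm x * norm x"
    by (subst mult_cj) (simp add: power2_eq_square norm_mult)
  then show ?thesis using False by (simp add: norm_mult)
qed simp

lemma cj_cj [simp]: "cj (cj x) = (x::'k::rc_field)"
proof (cases "x = 0")
  case False
  have "cj x * cj (cj x) = cj x * x"
    by (metis mult_cj norm_cj mult.commute)
  then show ?thesis using False by simp
qed simp

lemma cj_power: "cj (x ^ n) = cj (x::'k::rc_field) ^ n"
  by (induction n) (auto simp: cj_mult)

lemma cj_sum: "cj (sum f S) = (\<Sum>x\<in>S. cj (f x :: 'k::rc_field))"
  by (induction S rule: infinite_finite_induct) (auto simp: cj_add)

lemma cj_of_nat [simp]: "cj (of_nat n) = (of_nat n :: 'k::rc_field)"
  using cj_of_real[of "of_nat n", where 'k='k] by simp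

lemma bounded_linear_cj: "bounded_linear (cj :: 'k::rc_field \<Rightarrow> 'k)"
  by (rule bounded_linear_intro[of _ 1])
     (auto simp: cj_add scaleR_conv_of_real cj_mult cj_of_real)

lemma closed_nonneg_Reals: "closed (\<real>\<^sub>\<ge>\<^sub>0 :: 'k::rc_field set)"
proof -
  have "linear (of_real :: real \<Rightarrow> 'k)"
    by (rule bounded_linear.linear[OF bounded_linear_of_real])
  moreover have "inj (of_real :: real \<Rightarrow> 'k)" by (rule injI) simp
  ultimately have "closed (of_real ` {0..} :: 'k set)"
    by (intro closed_injective_linear_image) auto
  moreover have "(\<real>\<^sub>\<ge>\<^sub>0 :: 'k set) = of_real ` {0..}"
    by (auto simp: nonneg_Reals_def)
  ultimately show ?thesis by simp
qed

lemma vinner_add_left: "vinner (x + y) z = vinner x z + vinner y z"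
  by (simp add: vinner_def algebra_simps sum.distrib)

lemma vinner_add_right: "vinner x (y + z) = vinner x y + vinner x z"
  by (simp add: vinner_def algebra_simps sum.distrib cj_add)

lemma vinner_scale_left: "vinner (c *s x) y = c * vinner x y"
  by (simp add: vinner_def sum_distrib_left mult.assoc)

lemma vinner_scale_right: "vinner x (c *s y) = cj c * vinner x y"
  by (simp add: vinner_def sum_distrib_left cj_mult algebra_simps)

lemma vinner_0 [simp]: "vinner 0 x = 0" "vinner x 0 = 0"
  by (simp_all add: vinner_def)

lemma vinner_diff_left: "vinner (x - y) z = vinner x z - vinner y z"
  using vinner_add_left[of "x - y" y z] by simp

lemma vinner_sum_left: "vinner (sum f S) y = (\<Sum>x\<in>S. vinner (f x) y)"
  by (induction S rule: infinite_finite_induct) (auto simp: vinner_add_left)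

lemma vinner_commute: "vinner y x = cj (vinner x y)"
  by (simp add: vinner_def cj_sum cj_mult mult.commute)

lemma vinner_self: "vinner x x = of_real ((norm x)\<^sup>2)"
  by (simp add: vinner_def mult_cj norm_vec_def L2_set_def sum_nonneg)

lemma norm_vinner_le: "norm (vinner x y) \<le> norm x * norm y"
proof -
  have "norm (vinner x y) \<le> (\<Sum>i\<in>UNIV. \<bar>norm (x $ i)\<bar> * \<bar>norm (y $ i)\<bar>)"
    unfolding vinner_def by (rule sum_norm_le) (simp add: norm_mult)
  also have "\<dots> \<le> norm x * norm y"
    unfolding norm_vec_def by (rule L2_set_mult_ineq)
  finally show ?thesis .
qed

lemma vinner_axis: "vinner x (axis i 1) = x $ i"
proof -
  have "vinner x (axis i 1) = (\<Sum>j\<in>UNIV. if j = i then x $ j else 0)"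
    unfolding vinner_def by (rule sum.cong) (auto simp: axis_def)
  then show ?thesis by simp
qed

lemma norm_axis_one: "norm (axis i 1 :: 'k::rc_field ^ 'p) = 1"
proof -
  have "of_real ((norm (axis i 1 :: 'k ^ 'p))\<^sup>2) = (1 :: 'k)"
    unfolding vinner_self[symmetric] vinner_axis by (simp add: axis_def)
  then have "(norm (axis i 1 :: 'k ^ 'p))\<^sup>2 = 1" by (simp only: of_real_eq_1_iff)
  then show ?thesis
    using norm_ge_zero[of "axis i 1 :: 'k ^ 'p"] by (auto simp: power2_eq_1_iff simp del: norm_ge_zero)
qed

lemma vinner_eqI: "(\<And>e. vinner x e = vinner y e) \<Longrightarrow> x = y"
  by (metis vinner_axis vec_eq_iff)

lemma norm_vector_scalar [simp]:
  "norm (c *s x) = norm (c::'k::rc_field) * norm (x :: 'k ^ 'p)"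
  unfolding norm_vec_def
  by (simp add: norm_mult L2_set_right_distrib)

lemma bounded_linear_vinner_left: "bounded_linear (\<lambda>x. vinner x y)"
proof (rule bounded_linear_intro[of _ "norm y"])
  show "vinner (r *\<^sub>R x) y = r *\<^sub>R vinner x y" for r x
    by (simp add: vinner_def scaleR_sum_right)
qed (auto simp: vinner_add_left norm_vinner_le)

lemma bounded_linear_vector_scalar: "bounded_linear (\<lambda>x. c *s (x :: 'k::rc_field ^ 'p))"
  by (rule bounded_linear_intro[of _ "norm c"])
     (auto simp: vec_eq_iff algebra_simps)

lemma norm_le_card_bound:
  assumes "\<And>i. norm (x $ i) \<le> B"
  shows "norm (x :: 'k::rc_field ^ 'p) \<le> of_nat CARD('p) * B"
proof -
  have "norm x \<le> (\<Sum>i\<in>UNIV. norm (x $ i))"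
    unfolding norm_vec_def by (rule L2_set_le_sum) simp
  also have "\<dots> \<le> of_nat CARD('p) * B"
    using sum_bounded_above[of UNIV "\<lambda>i. norm (x $ i)" B] assms by simp
  finally show ?thesis .
qed

lemma norm_matrix_vector_le:
  fixes M :: "'k::rc_field ^ 'p ^ 'q"
  assumes "\<And>i j. norm (M $ i $ j) \<le> B"
  shows "norm (M *v x) \<le> of_nat CARD('q) * (of_nat CARD('p) * B * norm x)"
proof (rule norm_le_card_bound)
  fix i
  have "norm ((M *v x) $ i) \<le> (\<Sum>j\<in>UNIV. norm (M $ i $ j * x $ j))"
    unfolding matrix_vector_mult_def by (simp add: norm_sum)
  also have "\<dots> \<le> of_nat CARD('p) * (B * norm x)"
    using assms Finite_Cartesian_Product.norm_nth_le order_trans[OF norm_ge_zero assms]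
    by (intro sum_bounded_above order_trans[OF norm_mult_ineq] mult_mono) auto
  finally show "norm ((M *v x) $ i) \<le> of_nat CARD('p) * B * norm x" by (simp add: mult.assoc)
qed

text \<open>
One predicate serves for decay (\<open>R < 1\<close>) and for growth (\<open>R > 1\<close>).  For fixed \<open>R\<close> the least
admissible \<open>C\<close> is a weighted sup norm, and estimates below that are uniform in \<open>C\<close> express boundedness
with respect to this norm.
\<close>

definition geom_le :: "real \<Rightarrow> real \<Rightarrow> (nat \<Rightarrow> 'a::real_normed_vector) \<Rightarrow> bool" where
  "geom_le R C x \<longleftrightarrow> (\<forall>m. norm (x m) \<le> C * R ^ m)"

lemma geom_leD: "geom_le R C x \<Longrightarrow> norm (x m) \<le> C * R ^ m"
  by (simp add: geom_le_def)

lemma geom_le_const_nonneg: "geom_le R C x \<Longrightarrow> 0 \<le> C"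
  using geom_leD[of R C x 0] norm_ge_zero[of "x 0"] by (simp del: norm_ge_zero)

lemma geom_le_mono:
  assumes "geom_le R C x" "0 \<le> R" "R \<le> R'" "C \<le> C'"
  shows "geom_le R' C' x"
  unfolding geom_le_def
proof
  fix m
  have "C * R ^ m \<le> C' * R' ^ m"
    using assms geom_le_const_nonneg[OF assms(1)] by (intro mult_mono power_mono) auto
  then show "norm (x m) \<le> C' * R' ^ m" using geom_leD[OF assms(1), of m] by simp
qed

lemma geom_le_add:
  assumes "geom_le R C x" "geom_le R D y"
  shows "geom_le R (C + D) (\<lambda>m. x m + y m)"
  unfolding geom_le_def
  using norm_triangle_mono[OF geom_leD[OF assms(1)] geom_leD[OF assms(2)]]
  by (simp only: distrib_right) blast

lemma geom_le_minus: "geom_le R C (\<lambda>m. - x m) \<longleftrightarrow> geom_le R C x"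
  by (simp add: geom_le_def)

lemma geom_le_diff:
  assumes "geom_le R C x" "geom_le R D y"
  shows "geom_le R (C + D) (\<lambda>m. x m - y m)"
  using geom_le_add[OF assms(1), of D "\<lambda>m. - y m"] assms(2) by (simp add: geom_le_minus)

lemma geom_le_scale:
  assumes "geom_le R C x"
  shows "geom_le R (norm c * C) (\<lambda>m. (c::'k::rc_field) *s (x m :: 'k ^ 'p))"
  using assms by (auto simp: geom_le_def mult.assoc intro: mult_left_mono)

lemma half_powers_sums: "(\<lambda>n. B * (1/2) ^ n) sums (2 * B :: real)"
  using sums_mult[OF geometric_sums[of "1/2::real"], of B] by (simp add: mult.commute)

lemma half_powers_bound:
  fixes f :: "nat \<Rightarrow> 'a::banach"
  assumes bd: "\<And>n. norm (f n) \<le> B * (1/2) ^ n"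
  shows "summable (\<lambda>n. norm (f n))" and "summable f" and "norm (suminf f) \<le> 2 * B"
proof -
  have B: "summable (\<lambda>n. B * (1/2) ^ n)" "(\<Sum>n. B * (1/2) ^ n) = 2 * B"
    using half_powers_sums[of B] by (simp_all only: sums_iff)
  show 1: "summable (\<lambda>n. norm (f n))"
    by (rule summable_comparison_test'[OF B(1), of 0]) (simp only: real_norm_def abs_norm_cancel bd)
  then show "summable f" by (rule summable_norm_cancel)
  have "norm (suminf f) \<le> (\<Sum>n. norm (f n))" using 1 by (rule summable_norm)
  also have "\<dots> \<le> (\<Sum>n. B * (1/2) ^ n)" by (rule suminf_le[OF bd 1 B(1)])
  finally show "norm (suminf f) \<le> 2 * B" by (simp only: B(2))
qed

text \<open>
Every interchange of summations below is an instance of this lemma: the decay of the coefficients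
of an entire function always leaves room for geometric bounds in both indices.
\<close>

lemma double_series:
  fixes f :: "nat \<Rightarrow> nat \<Rightarrow> 'a::banach"
  assumes bd: "\<And>n m. norm (f n m) \<le> B * (1/2) ^ n * (1/2) ^ m"
  shows "((\<lambda>(n, m). f n m) has_sum (\<Sum>n. \<Sum>m. f n m)) UNIV"
    and "(\<Sum>n. \<Sum>m. f n m) = (\<Sum>m. \<Sum>n. f n m)"
    and "summable (\<lambda>n. \<Sum>m. f n m)"
proof -
  have main: "((\<lambda>(n, m). g n m) has_sum (\<Sum>n. \<Sum>m. g n m)) UNIV \<and> summable (\<lambda>n. \<Sum>m. g n m)"
    if bd: "\<And>n m. norm (g n m) \<le> B * (1/2) ^ n * (1/2) ^ m" for g :: "nat \<Rightarrow> nat \<Rightarrow> 'a"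
  proof -
    have B: "B \<ge> 0" using order_trans[OF norm_ge_zero bd[of 0 0]] by simp
    have abs1: "((\<lambda>m. g n m) has_sum (\<Sum>m. g n m)) UNIV" 
      and nrm: "norm (\<Sum>m. g n m) \<le> 2 * B * (1/2) ^ n"
      for n
      using half_powers_bound[of "g n" "B * (1/2) ^ n"] bd
      by (auto intro!: norm_summable_imp_has_sum summable_sums)
    have outer: "summable (\<lambda>n. norm (\<Sum>m. g n m))"
      using half_powers_bound(1)[of "\<lambda>n. \<Sum>m. g n m" "2 * B"] nrm by simp
    have half: "((\<lambda>n. C * (1/2) ^ n) has_sum (2 * C :: real)) UNIV" if "C \<ge> 0" for C
      using half_powers_sums[of C] that
      by (intro norm_summable_imp_has_sum) (auto simp: sums_iff)
    have S: "(\<lambda>(n, m). B * (1/2) ^ n * (1/2) ^ m :: real) summable_on (UNIV \<times> UNIV)"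
    proof (rule summable_on_SigmaI)
      show "((\<lambda>m. (\<lambda>(n, m). B * (1/2) ^ n * (1/2) ^ m :: real) (n, m)) has_sum 2 * (B * (1/2) ^ n)) UNIV"
        for n using half[of "B * (1/2) ^ n"] B by simp
      show "(\<lambda>n. 2 * (B * (1/2) ^ n) :: real) summable_on UNIV"
        using has_sum_imp_summable[OF half[of "2 * B"]] B by (simp add: mult.assoc)
    qed (use B in auto)
    have "(\<lambda>(n, m). g n m) abs_summable_on (UNIV \<times> UNIV)"
      using S by (rule Infinite_Sum.abs_summable_on_comparison_test') (auto simp: bd)
    then have "(\<lambda>(n, m). g n m) summable_on (UNIV \<times> UNIV)"
      by (rule abs_summable_summable)
    then obtain s where s: "((\<lambda>(n, m). g n m) has_sum s) (UNIV \<times> UNIV)"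
      by (auto simp: summable_on_def)
    have "((\<lambda>n. \<Sum>m. g n m) has_sum s) UNIV"
      using has_sum_SigmaD[OF s] abs1 by simp
    then have "s = (\<Sum>n. \<Sum>m. g n m)"
      by (meson has_sum_imp_sums sums_unique)
    then show ?thesis using s summable_norm_cancel[OF outer] by simp
  qed
  show 1: "((\<lambda>(n, m). f n m) has_sum (\<Sum>n. \<Sum>m. f n m)) UNIV"
    and "summable (\<lambda>n. \<Sum>m. f n m)" using main[of f] bd by auto
  have "norm (f m n) \<le> B * (1/2) ^ n * (1/2) ^ m" for n m
    using bd[of m n] by (simp only: mult.assoc mult.commute[of "(1/2) ^ m"])
  then have "((\<lambda>(m, n). f n m) has_sum (\<Sum>m. \<Sum>n. f n m)) UNIV"
    using main[of "\<lambda>m n. f n m"] by blast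
  then have "((\<lambda>(n, m). f n m) has_sum (\<Sum>m. \<Sum>n. f n m)) UNIV"
    using has_sum_reindex_bij_betw[of prod.swap UNIV UNIV "\<lambda>(n, m). f n m"] bij_swap
    by (simp add: case_prod_unfold prod.swap_def)
  then show "(\<Sum>n. \<Sum>m. f n m) = (\<Sum>m. \<Sum>n. f n m)"
    using 1 has_sum_unique by blast
qed

section \<open>Re-expansion of entire power series\<close>

text \<open>
The Taylor coefficients at \<open>v\<close> of the function with power series coefficients \<open>a\<close> at \<open>0\<close>.
\<close>

definition taylor_shift :: "'k::rc_field \<Rightarrow> (nat \<Rightarrow> 'k) \<Rightarrow> nat \<Rightarrow> 'k" where
  "taylor_shift v a n = (\<Sum>k. of_nat ((n + k) choose n) * v ^ k * a (n + k))"

text \<open>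
Termwise differentiation, applied \<open>n\<close> times.  The binomial coefficients propagate through the induction
by \<open>(n + 1) * (n + 1 + k choose n + 1) = (n + 1 + k) * (n + k choose n)\<close>.
\<close>

lemma deriv_funpow_power_series:
  fixes g :: "'k::rc_field \<Rightarrow> 'k"
  assumes "\<And>z. (\<lambda>n. a n * z ^ n) sums g z"
  shows "(\<lambda>k. fact n * (of_nat ((n + k) choose n) * z ^ k * a (n + k))) sums (deriv ^^ n) g z"
  using assms
proof (induction n arbitrary: a g)
  case 0
  then show ?case by (simp add: mult.commute)
next
  case (Suc n)
  have sm: "summable (\<lambda>n. a n * z ^ n)" for z using Suc.prems by (auto simp: sums_iff)
  have g: "g = (\<lambda>z. \<Sum>n. a n * z ^ n)" using Suc.prems by (auto simp: sums_iff)
  have "(\<lambda>n. diffs a n * z ^ n) sums deriv g z" for z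
    using termdiffs_strong_converges_everywhere[OF sm, of z] termdiff_converges_all[OF sm, of z]
    by (simp add: g DERIV_imp_deriv summable_sums)
  from Suc.IH[OF this]
  have "(\<lambda>k. fact n * (of_nat ((n + k) choose n) * z ^ k * diffs a (n + k)))
      sums (deriv ^^ Suc n) g z"
    by (simp add: funpow_swap1)
  moreover have "fact n * (of_nat ((n + k) choose n) * z ^ k * diffs a (n + k))
      = fact (Suc n) * (of_nat ((Suc n + k) choose Suc n) * z ^ k * a (Suc n + k))" for k
  proof -
    have "of_nat (Suc n) * of_nat (Suc (n + k) choose Suc n)
        = (of_nat (Suc (n + k)) * of_nat ((n + k) choose n) :: 'k)"
      using Suc_times_binomial[of n "n + k"] by (simp only: of_nat_mult[symmetric])
    then show ?thesis
      by (simp only: diffs_def fact_Suc add_Suc) (simp add: mult_ac del: of_nat_Suc of_nat_add binomial_Suc_Suc)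
  qed
  ultimately show ?case by simp
qed

lemma deriv_funpow_eq_taylor_shift:
  fixes g :: "'k::rc_field \<Rightarrow> 'k"
  assumes "\<And>z. (\<lambda>n. a n * z ^ n) sums g z"
  shows "(deriv ^^ n) g z = fact n * taylor_shift z a n"
    and "summable (\<lambda>k. of_nat ((n + k) choose n) * z ^ k * a (n + k))"
proof -
  have "(\<lambda>k. of_nat ((n + k) choose n) * z ^ k * a (n + k)) sums ((deriv ^^ n) g z / fact n)"
    using sums_divide[OF deriv_funpow_power_series[OF assms, where n = n and z = z], of "fact n"]
    by simp
  then show "(deriv ^^ n) g z = fact n * taylor_shift z a n"
    and "summable (\<lambda>k. of_nat ((n + k) choose n) * z ^ k * a (n + k))"
    by (simp_all add: sums_iff taylor_shift_def)
qed

lemma deriv_cj_funpow: "(deriv_cj ^^ m) g w = (deriv ^^ m) (\<lambda>v. g (cj v)) (cj w)"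
proof -
  have "(deriv_cj ^^ m) g = (\<lambda>w. (deriv ^^ m) (\<lambda>v. g (cj v)) (cj w))"
  proof (induction m)
    case (Suc m)
    then show ?case by (auto simp: deriv_cj_def)
  qed simp
  then show ?thesis by simp
qed

lemma binomial_power_le:
  assumes "0 \<le> (t::real)" "n \<le> M"
  shows "of_nat (M choose n) * t ^ (M - n) \<le> (1 + t) ^ M"
proof -
  have "of_nat (M choose n) * 1 ^ n * t ^ (M - n)
      \<le> (\<Sum>j\<le>M. of_nat (M choose j) * 1 ^ j * t ^ (M - j))"
    by (rule member_le_sum) (use assms in auto)
  then show ?thesis by (simp add: binomial_ring)
qed

text \<open>
The factor \<open>1 + norm v\<close> in the rate of decay pays for the binomial weights, since
\<open>(M choose n) * norm v ^ (M - n)\<close> is one term of the expansion of \<open>(1 + norm v) ^ M\<close>.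
\<close>

lemma taylor_shift_term_bound:
  fixes v :: "'k::rc_field"
  assumes "geom_le (q / (1 + norm v)) B a" "0 \<le> q" "n \<le> M"
  shows "norm (of_nat (M choose n) * v ^ (M - n) * a M) \<le> B * q ^ M"
proof -
  have nz: "1 + norm v \<noteq> 0" using norm_ge_zero[of v] by linarith
  have B: "0 \<le> B" using assms geom_le_const_nonneg by blast
  have "norm (of_nat (M choose n) * v ^ (M - n) * a M)
      = (of_nat (M choose n) * norm v ^ (M - n)) * norm (a M)"
    by (simp add: norm_mult norm_power)
  also have "\<dots> \<le> (1 + norm v) ^ M * (B * (q / (1 + norm v)) ^ M)"
    using assms by (intro mult_mono binomial_power_le geom_leD) auto
  also have "\<dots> = B * q ^ M" using nz by (simp add: power_divide)
  finally show ?thesis .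
qed

lemma taylor_shift_bound:
  fixes v :: "'k::rc_field"
  assumes "geom_le (q / (1 + norm v)) B a" "0 \<le> q" "q \<le> 1/2"
  shows "geom_le q (2 * B) (taylor_shift v a)"
    and "summable (\<lambda>k. of_nat ((n + k) choose n) * v ^ k * a (n + k))"
proof -
  have B: "0 \<le> B" using assms geom_le_const_nonneg by blast
  have *: "norm (of_nat ((n + k) choose n) * v ^ k * a (n + k)) \<le> B * q ^ n * (1/2) ^ k" for n k
  proof -
    have "norm (of_nat ((n + k) choose n) * v ^ k * a (n + k)) \<le> B * q ^ (n + k)"
      using taylor_shift_term_bound[OF assms(1,2), of n "n + k"] by simp
    also have "\<dots> \<le> B * q ^ n * (1/2) ^ k"
      unfolding power_add mult.assoc[symmetric]
      using assms B by (intro mult_left_mono power_mono) auto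
    finally show ?thesis .
  qed
  show "geom_le q (2 * B) (taylor_shift v a)"
    unfolding geom_le_def taylor_shift_def
    using half_powers_bound(3)[OF *] by (simp add: mult.assoc)
  show "summable (\<lambda>k. of_nat ((n + k) choose n) * v ^ k * a (n + k))"
    using half_powers_bound(2)[OF *] .
qed

text \<open>
Both sides are the sum of \<open>(M choose n) * v ^ (M - n) * a M * x n\<close> over all \<open>n \<le> M\<close>.  The rate \<open>1/4\<close>
makes this family doubly geometric, because \<open>(1/4) ^ M \<le> (1/2) ^ n * (1/2) ^ M\<close> for \<open>n \<le> M\<close>.
\<close>

lemma taylor_shift_adjoint:
  fixes v :: "'k::rc_field"
  assumes a: "geom_le (1/4 / (1 + norm v)) B a" and x: "\<And>n. norm (x n) \<le> X"
  shows "(\<Sum>n. taylor_shift v a n * x n)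
      = (\<Sum>M. a M * (\<Sum>n\<le>M. of_nat (M choose n) * v ^ (M - n) * x n))"
    and "summable (\<lambda>n. taylor_shift v a n * x n)"
proof -
  \<comment> \<open>Extended by \<open>0\<close> to all pairs, so that the triangular sum becomes a double series.\<close>
  define f where "f n M = (if n \<le> M then of_nat (M choose n) * v ^ (M - n) * a M * x n else 0)"
    for n M
  have B: "0 \<le> B" using a geom_le_const_nonneg by blast
  have X: "0 \<le> X" using order_trans[OF norm_ge_zero x] .
  have bd: "norm (f n M) \<le> (B * X) * (1/2) ^ n * (1/2) ^ M" for n M
  proof (cases "n \<le> M")
    case True
    have "norm (f n M) \<le> (B * (1/4) ^ M) * X"
      using True B unfolding f_def
      by (simp add: norm_mult[of _ "x n"] del: norm_mult)
         (intro mult_mono taylor_shift_term_bound a x; simp)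
    also have "(1/4::real) ^ M = (1/2) ^ M * (1/2) ^ M"
      by (simp flip: power_mult_distrib)
    also have "\<dots> \<le> (1/2) ^ n * (1/2) ^ M"
      using True by (intro mult_right_mono power_decreasing) auto
    finally have "norm (f n M) \<le> B * ((1/2) ^ n * (1/2) ^ M) * X"
      using B X by (simp add: mult_left_mono mult_right_mono)
    then show ?thesis by (simp only: mult_ac)
  qed (use B X in \<open>simp add: f_def\<close>)
  have row: "(\<Sum>M. f n M) = taylor_shift v a n * x n" for n
  proof -
    have "(\<lambda>k. of_nat ((n + k) choose n) * v ^ k * a (n + k)) sums taylor_shift v a n"
      using taylor_shift_bound(2)[OF a, of n] by (simp add: taylor_shift_def summable_sums)
    then have "(\<lambda>k. f n (k + n)) sums (taylor_shift v a n * x n)"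
      by (simp add: f_def add.commute[of _ n] sums_mult2)
    then have "(\<lambda>M. f n M) sums (taylor_shift v a n * x n)"
      by (subst sums_zero_iff_shift[symmetric, of n]) (auto simp: f_def)
    then show ?thesis by (simp add: sums_iff)
  qed
  have col: "(\<Sum>n. f n M) = a M * (\<Sum>n\<le>M. of_nat (M choose n) * v ^ (M - n) * x n)" for M
  proof -
    have "(\<Sum>n. f n M) = (\<Sum>n\<le>M. f n M)"
      by (rule suminf_finite) (auto simp: f_def)
    also have "\<dots> = a M * (\<Sum>n\<le>M. of_nat (M choose n) * v ^ (M - n) * x n)"
      by (simp add: f_def sum_distrib_left mult_ac)
    finally show ?thesis .
  qed
  show "(\<Sum>n. taylor_shift v a n * x n)
      = (\<Sum>M. a M * (\<Sum>n\<le>M. of_nat (M choose n) * v ^ (M - n) * x n))"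
    using double_series(2)[OF bd] by (simp add: row col)
  show "summable (\<lambda>n. taylor_shift v a n * x n)"
    using double_series(3)[OF bd] by (simp add: row)
qed

lemma radius_pos: "0 < c \<Longrightarrow> 0 < c / (1 + norm (x :: 'a::real_normed_vector))"
  by (simp add: add_pos_nonneg)

lemma half_radius_pos: "0 < 1/2 / (1 + norm (x :: 'a::real_normed_vector))"
  and quarter_radius_pos: "0 < 1/4 / (1 + norm (x :: 'a::real_normed_vector))"
  by (rule radius_pos, simp)+

lemma radius_power: "(c / (1 + norm x)) ^ M * (1 + norm (x :: 'a::real_normed_vector)) ^ M = c ^ M"
  using radius_pos[of 1 x] by (simp flip: power_mult_distrib)

text \<open>
The matrix re-expanded in its row index around \<open>z\<close> and in its column index around \<open>v\<close>, applied to a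
bounded sequence \<open>x\<close>: the re-expansion in the columns moves to \<open>x\<close> as its adjoint, and the one in the
rows can be performed after the summation over the columns.
\<close>

lemma double_taylor_shift:
  fixes z v :: "'k::rc_field"
  assumes a: "\<And>N M. norm (a N M) \<le> C * (1/2 / (1 + norm z)) ^ N * (1/4 / (1 + norm v)) ^ M"
    and x: "\<And>n. norm (x n) \<le> X"
  defines "D \<equiv> \<lambda>N m. taylor_shift v (a N) m"
    and "y \<equiv> \<lambda>N. \<Sum>M. a N M * (\<Sum>n\<le>M. of_nat (M choose n) * v ^ (M - n) * x n)"
  shows "norm (taylor_shift z (\<lambda>N. D N m) n) \<le> 4 * C * (1/2) ^ m"
    and "(\<Sum>m. taylor_shift z (\<lambda>N. D N m) n * x m) = taylor_shift z y n"
    and "summable (\<lambda>k. of_nat ((n + k) choose n) * z ^ k * y (n + k))"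
proof -
  have C: "0 \<le> C" using order_trans[OF norm_ge_zero a[of 0 0]] by simp
  have X: "0 \<le> X" using order_trans[OF norm_ge_zero x] .
  have row: "geom_le (1/4 / (1 + norm v)) (C * (1/2 / (1 + norm z)) ^ N) (a N)" for N
    using a by (auto simp: geom_le_def)
  have D: "norm (D N m) \<le> 2 * C * (1/4) ^ m * (1/2 / (1 + norm z)) ^ N" for N m
    using geom_leD[OF taylor_shift_bound(1)[OF row[of N]], of m] by (simp add: D_def mult_ac)
  have col: "geom_le (1/2 / (1 + norm z)) (2 * C * (1/4) ^ m) (\<lambda>N. D N m)" for m
    using D by (auto simp: geom_le_def)
  have le: "(1/4::real) ^ m \<le> (1/2) ^ m" for m by (rule power_mono) auto
  have "norm (taylor_shift z (\<lambda>N. D N m) n) \<le> 2 * (2 * C * (1/4) ^ m) * (1/2) ^ n"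
    using geom_leD[OF taylor_shift_bound(1)[OF col[of m]], of n] by simp
  also have "\<dots> \<le> 2 * (2 * C * (1/2) ^ m) * 1"
    using C le by (intro mult_mono) (auto simp: power_le_one)
  finally show "norm (taylor_shift z (\<lambda>N. D N m) n) \<le> 4 * C * (1/2) ^ m" by simp
  define f where "f m k = of_nat ((n + k) choose n) * z ^ k * D (n + k) m * x m" for m k
  have bd: "norm (f m k) \<le> (2 * C * X) * (1/2) ^ m * (1/2) ^ k" for m k
  proof -
    have "norm (f m k) \<le> 2 * C * (1/4) ^ m * (1/2) ^ (n + k) * X"
      using taylor_shift_term_bound[OF col[of m], of n "n + k"] x[of m] C
      unfolding f_def by (subst norm_mult) (intro mult_mono; simp)
    also have "\<dots> \<le> 2 * C * (1/2) ^ m * (1/2) ^ k * X"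
      using C X le by (intro mult_mono power_decreasing) auto
    finally show ?thesis by (simp only: mult_ac)
  qed
  have y: "y N = (\<Sum>m. D N m * x m)" and Ds: "summable (\<lambda>m. D N m * x m)" for N
    using taylor_shift_adjoint[OF row x] by (simp_all add: y_def D_def)
  have inner: "(\<Sum>m. f m k) = of_nat ((n + k) choose n) * z ^ k * y (n + k)" for k
    using suminf_mult[OF Ds[of "n + k"], of "of_nat ((n + k) choose n) * z ^ k"]
    by (simp add: f_def y mult.assoc)
  have "summable (\<lambda>k. of_nat ((n + k) choose n) * z ^ k * D (n + k) m)" for m
    by (rule taylor_shift_bound(2)[OF col]) auto
  then have outer: "(\<Sum>k. f m k) = taylor_shift z (\<lambda>N. D N m) n * x m" for m
    by (simp add: f_def taylor_shift_def suminf_mult2)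
  have bd': "norm (f m k) \<le> (2 * C * X) * (1/2) ^ k * (1/2) ^ m" for k m
    using bd[of m k] by (simp only: mult_ac)
  show "(\<Sum>m. taylor_shift z (\<lambda>N. D N m) n * x m) = taylor_shift z y n"
    using double_series(2)[OF bd] by (simp add: inner outer taylor_shift_def[of z y])
  show "summable (\<lambda>k. of_nat ((n + k) choose n) * z ^ k * y (n + k))"
    using double_series(3)[of "\<lambda>k m. f m k", OF bd'] by (simp add: inner)
qed

text \<open>
The adjoint of \<open>taylor_shift w\<close>, acting on vector sequences.
\<close>

definition cotaylor :: "'k::rc_field \<Rightarrow> (nat \<Rightarrow> 'k ^ 'p) \<Rightarrow> nat \<Rightarrow> 'k ^ 'p" where
  "cotaylor w \<xi> M = (\<Sum>n\<le>M. (of_nat (M choose n) * cj w ^ (M - n)) *s \<xi> n)"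

lemma cotaylor_growth:
  assumes "\<And>n. norm (\<xi> n) \<le> X"
  shows "geom_le (1 + norm w) X (cotaylor w \<xi>)"
  unfolding geom_le_def
proof
  fix M
  have X: "0 \<le> X" using order_trans[OF norm_ge_zero assms] .
  have "norm (cotaylor w \<xi> M) \<le> (\<Sum>n\<le>M. of_nat (M choose n) * 1 ^ n * norm w ^ (M - n) * X)"
    unfolding cotaylor_def using X assms
    by (intro sum_norm_le) (auto simp: norm_mult norm_power intro!: mult_mono)
  also have "\<dots> = X * (1 + norm w) ^ M"
    by (simp add: binomial_ring sum_distrib_left mult.commute)
  finally show "norm (cotaylor w \<xi> M) \<le> X * (1 + norm w) ^ M" .
qed

lemma vector_taylor_shift_bound:
  fixes Y :: "nat \<Rightarrow> 'k::rc_field ^ 'p"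
  assumes Y: "geom_le (1/4 / (1 + norm z)) B Y"
    and S: "\<And>n i. S n $ i = taylor_shift z (\<lambda>N. Y N $ i) n"
  shows "geom_le (1/4) (of_nat CARD('p) * (2 * B)) S"
proof -
  have Yi: "geom_le (1/4 / (1 + norm z)) B (\<lambda>N. Y N $ i)" for i
    using Y Finite_Cartesian_Product.norm_nth_le order_trans unfolding geom_le_def by blast
  show "geom_le (1/4) (of_nat CARD('p) * (2 * B)) S"
    unfolding geom_le_def
  proof
    fix n
    have "norm (S n) \<le> of_nat CARD('p) * (2 * B * (1/4) ^ n)"
      unfolding S by (rule norm_le_card_bound)
        (use geom_leD[OF taylor_shift_bound(1)[OF Yi], where m = n] S in simp)
    then show "norm (S n) \<le> of_nat CARD('p) * (2 * B) * (1/4) ^ n" by (simp only: mult_ac)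
  qed
qed

text \<open>
The componentwise adjunction of \<open>taylor_shift_adjoint\<close>, read in the inner product, which conjugates
its second argument and so turns \<open>z\<close> into the \<open>cj z\<close> of \<open>cotaylor\<close>.
\<close>

lemma vector_taylor_adjoint:
  fixes Y :: "nat \<Rightarrow> 'k::rc_field ^ 'p"
  assumes Y: "geom_le (1/4 / (1 + norm z)) B Y" and \<eta>: "\<And>n. norm (\<eta> n) \<le> X"
    and S: "\<And>n i. S n $ i = taylor_shift z (\<lambda>N. Y N $ i) n"
  shows "ell2_inner S \<eta> = ell2_inner Y (cotaylor z \<eta>)"
    and "summable (\<lambda>n. vinner (S n) (\<eta> n))"
proof -
  have Yi: "geom_le (1/4 / (1 + norm z)) B (\<lambda>N. Y N $ i)" for i
    using Y Finite_Cartesian_Product.norm_nth_le order_trans unfolding geom_le_def by blast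
  have B: "0 \<le> B" using Y geom_le_const_nonneg by blast
  have X: "0 \<le> X" using order_trans[OF norm_ge_zero \<eta>] .
  have \<eta>i: "norm (cj (\<eta> n $ i)) \<le> X" for n i
    using Finite_Cartesian_Product.norm_nth_le[of "\<eta> n" i] \<eta>[of n] by simp
  note adj = taylor_shift_adjoint[OF Yi \<eta>i]
  have co: "(\<Sum>n\<le>M. of_nat (M choose n) * z ^ (M - n) * cj (\<eta> n $ i)) = cj (cotaylor z \<eta> M $ i)" for M i
    by (simp add: cotaylor_def cj_sum cj_mult cj_power)
  have p: "0 < 1 + norm z" by (simp add: add_pos_nonneg)
  have sm: "summable (\<lambda>M. Y M $ i * cj (cotaylor z \<eta> M $ i))" for i
  proof (rule half_powers_bound(2))
    fix M
    have "norm (cotaylor z \<eta> M $ i) \<le> X * (1 + norm z) ^ M"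
      using Finite_Cartesian_Product.norm_nth_le[of "cotaylor z \<eta> M" i]
        geom_leD[OF cotaylor_growth[of \<eta>, OF \<eta>], of z M] by linarith
    then have "norm (Y M $ i * cj (cotaylor z \<eta> M $ i))
        \<le> (B * (1/4 / (1 + norm z)) ^ M) * (X * (1 + norm z) ^ M)"
      using geom_leD[OF Yi] B p by (auto simp: norm_mult intro!: mult_mono)
    also have "\<dots> = B * X * (1/4) ^ M"
      unfolding radius_power[of "1/4" z M, symmetric] by (simp only: mult_ac)
    also have "\<dots> \<le> B * X * (1/2) ^ M"
      using B X by (intro mult_left_mono power_mono) auto
    finally show "norm (Y M $ i * cj (cotaylor z \<eta> M $ i)) \<le> B * X * (1/2) ^ M" .
  qed
  have "ell2_inner S \<eta> = (\<Sum>i\<in>UNIV. \<Sum>n. taylor_shift z (\<lambda>N. Y N $ i) n * cj (\<eta> n $ i))"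
    unfolding ell2_inner_def vinner_def S by (rule suminf_sum) (rule adj(2))
  also have "\<dots> = (\<Sum>i\<in>UNIV. \<Sum>M. Y M $ i * cj (cotaylor z \<eta> M $ i))"
    by (simp only: adj(1) co)
  also have "\<dots> = ell2_inner Y (cotaylor z \<eta>)"
    unfolding ell2_inner_def vinner_def by (rule suminf_sum[symmetric]) (rule sm)
  finally show "ell2_inner S \<eta> = ell2_inner Y (cotaylor z \<eta>)" .
  show "summable (\<lambda>n. vinner (S n) (\<eta> n))"
    unfolding vinner_def S by (rule summable_sum) (rule adj(2))
qed

section \<open>Taylor blocks of an entire kernel\<close>

text \<open>
Adding one index to a finite set that already gives the sum up to \<open>1\<close> changes the partial sum by less
than \<open>2\<close>; the finitely many other terms are bounded anyway.
\<close>

lemma has_sum_bounded_terms: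
  fixes f :: "'a \<Rightarrow> 'b::real_normed_vector"
  assumes "(f has_sum S) UNIV"
  shows "\<exists>C. \<forall>x. norm (f x) \<le> C"
proof -
  have "eventually (\<lambda>F. dist (sum f F) S < 1) (finite_subsets_at_top UNIV)"
    using assms by (auto simp: has_sum_def tendsto_iff)
  then obtain X where X: "finite X" "\<And>F. finite F \<Longrightarrow> X \<subseteq> F \<Longrightarrow> dist (sum f F) S < 1"
    by (auto simp: eventually_finite_subsets_at_top)
  have "norm (f x) \<le> 2 + (\<Sum>y\<in>X. norm (f y))" for x
  proof (cases "x \<in> X")
    case True
    then have "norm (f x) \<le> (\<Sum>y\<in>X. norm (f y))" using X(1) by (intro member_le_sum) auto
    then show ?thesis by simp
  next
    case False
    have "dist (sum f (insert x X)) (sum f X) < 1 + 1"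
      using X(1) by (intro dist_triangle_less_add[of _ S] X(2)) auto
    then have "norm (f x) < 2" using False X(1) by (simp add: dist_norm)
    then show ?thesis by (simp add: add_increasing2 less_imp_le sum_nonneg)
  qed
  then show ?thesis by blast
qed

locale entire_expansion =
  fixes A :: "nat \<Rightarrow> nat \<Rightarrow> 'k::rc_field ^ 'p ^ 'p" and K :: "'k \<Rightarrow> 'k \<Rightarrow> 'k ^ 'p ^ 'p"
  assumes expansion:
    "((\<lambda>(n, m). A n m $ i $ j * z ^ n * cj w ^ m) has_sum K z w $ i $ j) UNIV"
begin

text \<open>
The terms of the series at \<open>z = 1/r\<close>, \<open>w = 1/s\<close> are bounded.
\<close>

lemma entry_decay:
  assumes "0 < r" "0 < s"
  shows "\<exists>C\<ge>0. \<forall>n m i j. norm (A n m $ i $ j) \<le> C * r ^ n * s ^ m"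
proof -
  have "\<exists>C. \<forall>n m. norm (A n m $ i $ j) \<le> C * r ^ n * s ^ m" for i j
  proof -
    obtain C where C: "norm (A n m $ i $ j * of_real (1/r) ^ n * cj (of_real (1/s)) ^ m) \<le> C" for n m
      using has_sum_bounded_terms[OF expansion[of i j "of_real (1/r)" "of_real (1/s)"]] by auto
    have "norm (A n m $ i $ j) / (r ^ n * s ^ m) \<le> C" for n m
      using C[of n m] assms by (simp add: norm_mult norm_power norm_divide power_one_over field_simps)
    then have "norm (A n m $ i $ j) \<le> C * r ^ n * s ^ m" for n m
      using assms by (simp add: pos_divide_le_eq mult.assoc)
    then show ?thesis by blast
  qed
  then obtain C where C: "norm (A n m $ i $ j) \<le> C i j * r ^ n * s ^ m" for n m i j by metis
  have C0: "0 \<le> C i j" for i j using order_trans[OF norm_ge_zero C[of 0 0]] by simp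
  have "C i j \<le> (\<Sum>i\<in>UNIV. \<Sum>j\<in>UNIV. C i j)" for i j
    using C0 by (intro order_trans[OF member_le_sum[of j UNIV "C i"]] member_le_sum[of i UNIV "\<lambda>i. sum (C i) UNIV"])
      (auto intro: sum_nonneg)
  then have "norm (A n m $ i $ j) \<le> (\<Sum>i\<in>UNIV. \<Sum>j\<in>UNIV. C i j) * r ^ n * s ^ m" for n m i j
    using assms by (intro order_trans[OF C] mult_right_mono) auto
  then show ?thesis using C0 by (intro exI[of _ "\<Sum>i\<in>UNIV. \<Sum>j\<in>UNIV. C i j"]) (auto intro!: sum_nonneg)
qed

lemma block_decay:
  assumes "0 < r" "0 < s"
  shows "\<exists>C\<ge>0. \<forall>n m x. norm (A n m *v x) \<le> C * r ^ n * s ^ m * norm x"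
proof -
  obtain C where C: "0 \<le> C" "norm (A n m $ i $ j) \<le> C * r ^ n * s ^ m" for n m i j
    using entry_decay[OF assms] by auto
  show ?thesis
    using norm_matrix_vector_le[of "A _ _", OF C(2)] C(1)
    by (intro exI[of _ "of_nat CARD('p) * (of_nat CARD('p) * C)"]) (auto simp: mult_ac)
qed

text \<open>
The matrix \<open>A\<close> maps geometric growth of any rate \<open>R\<close> to geometric decay of any rate \<open>r\<close>, boundedly in
the weighted sup norms.
\<close>

lemma block_op_bounds:
  assumes "0 < r" "0 < R"
  obtains D where "0 \<le> D"
    and "\<And>C \<Xi>. geom_le R C \<Xi> \<Longrightarrow> geom_le r (D * C) (block_op A \<Xi>)"
    and "\<And>C \<Xi> n. geom_le R C \<Xi> \<Longrightarrow> summable (\<lambda>m. A n m *v \<Xi> m)"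
proof -
  obtain B where B: "0 \<le> B" "norm (A n m *v x) \<le> B * r ^ n * (1 / (2 * R)) ^ m * norm x" for n m x
    using block_decay[of r "1 / (2 * R)"] assms by auto
  have bd: "norm (A n m *v \<Xi> m) \<le> B * r ^ n * C * (1/2) ^ m" if "geom_le R C \<Xi>" for C n m \<Xi>
  proof -
    have "norm (A n m *v \<Xi> m) \<le> B * r ^ n * (1 / (2 * R)) ^ m * (C * R ^ m)"
      using B assms geom_leD[OF that, of m] by (intro order_trans[OF B(2)] mult_left_mono) auto
    also have "\<dots> = B * r ^ n * C * (1/2) ^ m"
      using assms by (simp add: power_divide power_mult_distrib)
    finally show ?thesis .
  qed
  show ?thesis
  proof
    show "0 \<le> 2 * B" using B by simp
    fix C and \<Xi> :: "nat \<Rightarrow> 'k ^ 'p" assume *: "geom_le R C \<Xi>"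
    show "geom_le r (2 * B * C) (block_op A \<Xi>)"
      unfolding geom_le_def block_op_def
      using half_powers_bound(3)[OF bd[OF *]] by (simp add: mult_ac)
    show "summable (\<lambda>m. A n m *v \<Xi> m)" for n
      using half_powers_bound(2)[OF bd[OF *]] .
  qed
qed

lemma block_summable:
  assumes "geom_le R C \<Xi>" "0 < R"
  shows "summable (\<lambda>m. A n m *v \<Xi> m)"
  using block_op_bounds[of 1 R] assms by (metis zero_less_one)

text \<open>
Differentiating in \<open>cj w\<close> and then in \<open>z\<close> re-expands the double series in the columns and then in the
rows.  After the first step the result has to be rewritten as a power series in \<open>z\<close>, which is an
interchange of summations.
\<close>

lemma taylor_block_eq:
  "taylor_block K z w n m $ i $ j
    = taylor_shift z (\<lambda>N. taylor_shift (cj w) (\<lambda>M. A N M $ i $ j) m) n"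
proof -
  define a where "a N M = A N M $ i $ j" for N M
  define b where "b z' M = (\<Sum>N. a N M * z' ^ N)" for z' M
  define D where "D N = taylor_shift (cj w) (a N) m" for N
  \<comment> \<open>For \<open>l = 0\<close> this is the expansion of \<open>K\<close> in powers of \<open>cj w\<close>; for \<open>l = m\<close> it is the
    power series in \<open>z\<close> of the derivative in \<open>cj w\<close>.\<close>
  have resum: "summable (\<lambda>k. of_nat ((l + k) choose l) * u ^ k * b z' (l + k))"
      "(\<lambda>N. taylor_shift u (a N) l * z' ^ N) sums taylor_shift u (b z') l"
      "((\<lambda>(k, N). of_nat ((l + k) choose l) * u ^ k * (z' ^ N * a N (l + k)))
          has_sum taylor_shift u (b z') l) UNIV" for l z' u
  proof -
    obtain C where C0: "0 \<le> C"
      and C: "norm (a N M) \<le> C * (1/2 / (1 + norm z')) ^ N * (1/2 / (1 + norm u)) ^ M" for N M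
      using entry_decay[OF radius_pos[of "1/2" z'] radius_pos[of "1/2" u]] unfolding a_def by auto
    have aN: "geom_le (1/2 / (1 + norm u)) (C * (1/2 / (1 + norm z')) ^ N) (a N)" for N
      using C by (simp add: geom_le_def)
    have aM: "geom_le (1/2 / (1 + norm z')) (C * (1/2 / (1 + norm u)) ^ M) (\<lambda>N. a N M)" for M
      unfolding geom_le_def by (metis C mult.assoc mult.commute)
    have zN: "norm (z' ^ N * a N M) \<le> C * (1/2 / (1 + norm u)) ^ M * (1/2) ^ N" for N M
      using taylor_shift_term_bound[OF aM[of M], where n = 0 and M = N] by simp
    then have zaN: "geom_le (1/2 / (1 + norm u)) (C * (1/2) ^ N) (\<lambda>M. z' ^ N * a N M)" for N
      by (simp add: geom_le_def mult_ac)
    define h where "h k N = of_nat ((l + k) choose l) * u ^ k * (z' ^ N * a N (l + k))" for k N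
    have bd: "norm (h k N) \<le> C * (1/2) ^ k * (1/2) ^ N" for k N
    proof -
      have "norm (h k N) \<le> C * (1/2) ^ N * (1/2) ^ (l + k)"
        using taylor_shift_term_bound[OF zaN[of N], where n = l and M = "l + k"] by (simp add: h_def)
      also have "\<dots> \<le> C * (1/2) ^ N * (1/2) ^ k"
        using C0 by (intro mult_left_mono power_decreasing) auto
      finally show ?thesis by (simp only: mult_ac)
    qed
    have bd': "norm (h k N) \<le> C * (1/2) ^ N * (1/2) ^ k" for k N
      using bd[of k N] by (simp only: mult_ac)
    have "(\<Sum>N. h k N) = of_nat ((l + k) choose l) * u ^ k * b z' (l + k)" for k
      unfolding h_def b_def
      by (subst suminf_mult[OF half_powers_bound(2)[OF zN]]) (simp add: mult.commute)
    moreover have "(\<Sum>k. h k N) = taylor_shift u (a N) l * z' ^ N" for N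
    proof -
      have "summable (\<lambda>k. of_nat ((l + k) choose l) * u ^ k * a N (l + k))"
        by (rule taylor_shift_bound(2)[OF aN]) auto
      from suminf_mult2[OF this, of "z' ^ N"] show ?thesis
        by (simp add: h_def taylor_shift_def mult_ac)
    qed
    ultimately show "summable (\<lambda>k. of_nat ((l + k) choose l) * u ^ k * b z' (l + k))"
      "(\<lambda>N. taylor_shift u (a N) l * z' ^ N) sums taylor_shift u (b z') l"
      "((\<lambda>(k, N). of_nat ((l + k) choose l) * u ^ k * (z' ^ N * a N (l + k)))
          has_sum taylor_shift u (b z') l) UNIV"
      using double_series[OF bd] double_series(3)[of "\<lambda>N k. h k N", OF bd']
      by (simp_all add: h_def[symmetric] taylor_shift_def[of u "b z'"] sums_iff)
  qed
  have ps: "(\<lambda>M. b z' M * u ^ M) sums K z' (cj u) $ i $ j" for z' u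
  proof -
    have "((\<lambda>(N, M). a N M * z' ^ N * u ^ M) has_sum taylor_shift u (b z') 0) UNIV"
      using resum(3)[of 0 u z'] has_sum_reindex_bij_betw[of prod.swap UNIV UNIV
          "\<lambda>(N, M). a N M * z' ^ N * u ^ M"] bij_swap
      by (simp add: case_prod_unfold prod.swap_def mult_ac)
    moreover have "((\<lambda>(N, M). a N M * z' ^ N * u ^ M) has_sum K z' (cj u) $ i $ j) UNIV"
      using expansion[of i j z' "cj u"] by (simp add: a_def)
    ultimately have "taylor_shift u (b z') 0 = K z' (cj u) $ i $ j"
      using has_sum_unique by blast
    then show ?thesis
      using resum(1)[of 0 u z'] by (simp add: taylor_shift_def mult.commute sums_iff)
  qed
  have inner: "(deriv_cj ^^ m) (\<lambda>w'. K z' w' $ i $ j) w = fact m * taylor_shift (cj w) (b z') m" for z'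
    unfolding deriv_cj_funpow by (rule deriv_funpow_eq_taylor_shift(1)[OF ps])
  have D: "(\<lambda>N. D N * z' ^ N) sums taylor_shift (cj w) (b z') m" for z'
    unfolding D_def by (rule resum(2))
  have sm: "summable (\<lambda>k. of_nat ((n + k) choose n) * z ^ k * D (n + k))"
    by (rule deriv_funpow_eq_taylor_shift(2)[OF D])
  have "(deriv ^^ n) (\<lambda>z'. (deriv_cj ^^ m) (\<lambda>w'. K z' w' $ i $ j) w) z
      = fact n * taylor_shift z (\<lambda>N. fact m * D N) n"
    unfolding inner
    by (rule deriv_funpow_eq_taylor_shift(1)) (use sums_mult[OF D, of "fact m"] in \<open>simp add: mult.assoc\<close>)
  also have "\<dots> = fact n * (fact m * taylor_shift z D n)"
    using suminf_mult[OF sm, of "fact m"] by (simp add: taylor_shift_def mult_ac)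
  finally show ?thesis
    unfolding D_def a_def by (simp add: taylor_block_def)
qed

text \<open>
The Taylor operator as the composition of \<open>cotaylor w\<close>, the coefficient matrix and the re-expansion
around \<open>z\<close>.  The coefficient matrix is where all of \<open>K\<close> enters; the outer factors depend only on the
points.
\<close>

lemma taylor_op_factor:
  assumes \<xi>: "\<And>n. norm (\<xi> n) \<le> X"
  shows "summable (\<lambda>m. taylor_block K z w n m *v \<xi> m)"
    and "taylor_op K z w \<xi> n $ i = taylor_shift z (\<lambda>N. block_op A (cotaylor w \<xi>) N $ i) n"
proof -
  have X: "0 \<le> X" using order_trans[OF norm_ge_zero \<xi>] .
  obtain C where C0: "0 \<le> C"
    and C: "norm (A N M $ i $ j) \<le> C * (1/2 / (1 + norm z)) ^ N * (1/4 / (1 + norm (cj w))) ^ M"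
    for N M i j
    using entry_decay[OF radius_pos[of "1/2" z] radius_pos[of "1/4" "cj w"]] by auto
  have \<xi>j: "norm (\<xi> n $ j) \<le> X" for n j
    using Finite_Cartesian_Product.norm_nth_le[of "\<xi> n" j] \<xi>[of n] by linarith
  define x where "x M j = (\<Sum>n\<le>M. of_nat (M choose n) * cj w ^ (M - n) * \<xi> n $ j)" for M j
  have dt1: "norm (taylor_block K z w n m $ i $ j) \<le> 4 * C * (1/2) ^ m" for n m i j
    unfolding taylor_block_eq
    by (rule double_taylor_shift(1)[where a = "\<lambda>N M. A N M $ i $ j", OF C \<xi>j])
  note dt = double_taylor_shift[where a = "\<lambda>N M. A N M $ i $ j" and x = "\<lambda>n. \<xi> n $ j" for i j,
      OF C \<xi>j,
      folded taylor_block_eq, folded x_def]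
  have "norm (taylor_block K z w n m *v \<xi> m)
      \<le> of_nat CARD('p) * (of_nat CARD('p) * (4 * C) * X) * (1/2) ^ m" for m
  proof -
    have "norm (taylor_block K z w n m *v \<xi> m)
        \<le> of_nat CARD('p) * (of_nat CARD('p) * (4 * C * (1/2) ^ m) * norm (\<xi> m))"
      by (rule norm_matrix_vector_le) (rule dt1)
    also have "\<dots> \<le> of_nat CARD('p) * (of_nat CARD('p) * (4 * C * (1/2) ^ m) * X)"
      using C0 \<xi> by (intro mult_left_mono) auto
    finally show ?thesis by (simp only: mult_ac)
  qed
  then show sm: "summable (\<lambda>m. taylor_block K z w n m *v \<xi> m)"
    by (rule half_powers_bound(2))
  have smj: "summable (\<lambda>m. taylor_block K z w n m $ i $ j * \<xi> m $ j)" for j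
  proof (rule half_powers_bound(2))
    fix m
    have "norm (taylor_block K z w n m $ i $ j * \<xi> m $ j) \<le> (4 * C * (1/2) ^ m) * X"
      using C0 by (auto simp: norm_mult intro!: mult_mono dt1 \<xi>j)
    then show "norm (taylor_block K z w n m $ i $ j * \<xi> m $ j) \<le> 4 * C * X * (1/2) ^ m"
      by (simp only: mult_ac)
  qed
  have co: "cotaylor w \<xi> M $ j = x M j" for M j
    by (simp add: cotaylor_def x_def)
  define y where "y N j = (\<Sum>M. A N M $ i $ j * x M j)" for N j
  have w: "0 < 1 + norm w" by (simp add: add_pos_nonneg)
  have Asm: "summable (\<lambda>M. A N M $ i $ j * x M j)" for N j
  proof (rule half_powers_bound(2))
    fix M
    have "norm (x M j) \<le> X * (1 + norm w) ^ M"
      using geom_leD[OF cotaylor_growth[of \<xi>, OF \<xi>], of w M]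
        Finite_Cartesian_Product.norm_nth_le[of "cotaylor w \<xi> M" j] by (simp add: co)
    then have "norm (A N M $ i $ j * x M j)
        \<le> (C * (1/2 / (1 + norm z)) ^ N * (1/4 / (1 + norm (cj w))) ^ M) * (X * (1 + norm w) ^ M)"
      using C X C0 by (auto simp: norm_mult intro!: mult_mono)
    also have "\<dots> = C * (1/2 / (1 + norm z)) ^ N * X * (1/4) ^ M"
      unfolding radius_power[of "1/4" w M, symmetric] norm_cj by (simp only: mult_ac)
    also have "\<dots> \<le> C * (1/2 / (1 + norm z)) ^ N * X * (1/2) ^ M"
      using C0 X by (intro mult_left_mono power_mono) auto
    finally show "norm (A N M $ i $ j * x M j) \<le> C * (1/2 / (1 + norm z)) ^ N * X * (1/2) ^ M" .
  qed
  have blk: "block_op A (cotaylor w \<xi>) N $ i = (\<Sum>j\<in>UNIV. y N j)" for N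
  proof -
    have "summable (\<lambda>m. A N m *v cotaylor w \<xi> m)"
      using block_summable[OF cotaylor_growth[of \<xi>, OF \<xi>] w] by blast
    then have "block_op A (cotaylor w \<xi>) N $ i = (\<Sum>M. (A N M *v cotaylor w \<xi> M) $ i)"
      unfolding block_op_def by (rule bounded_linear.suminf[OF bounded_linear_vec_nth])
    also have "\<dots> = (\<Sum>M. \<Sum>j\<in>UNIV. A N M $ i $ j * x M j)"
      by (simp add: matrix_vector_mult_def co)
    also have "\<dots> = (\<Sum>j\<in>UNIV. y N j)"
      unfolding y_def by (rule suminf_sum) (rule Asm)
    finally show ?thesis .
  qed
  have "taylor_op K z w \<xi> n $ i = (\<Sum>m. (taylor_block K z w n m *v \<xi> m) $ i)"
    unfolding taylor_op_def block_op_def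
    by (rule bounded_linear.suminf[OF bounded_linear_vec_nth sm])
  also have "\<dots> = (\<Sum>m. \<Sum>j\<in>UNIV. taylor_block K z w n m $ i $ j * \<xi> m $ j)"
    by (simp add: matrix_vector_mult_def)
  also have "\<dots> = (\<Sum>j\<in>UNIV. taylor_shift z (\<lambda>N. y N j) n)"
    by (subst suminf_sum) (auto simp: smj dt(2) y_def)
  also have "\<dots> = taylor_shift z (\<lambda>N. \<Sum>j\<in>UNIV. y N j) n"
    unfolding taylor_shift_def sum_distrib_left
    by (subst suminf_sum) (auto simp: y_def intro: dt(3))
  finally show "taylor_op K z w \<xi> n $ i = taylor_shift z (\<lambda>N. block_op A (cotaylor w \<xi>) N $ i) n"
    by (simp add: blk)
qed

end

section \<open>Density of the combinations of evaluation sequences\<close>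

text \<open>
A finite combination of evaluation sequences: pairing the coefficients of an entire function with
\<open>\<lambda>m. cj h ^ m *s g h\<close> evaluates the function at \<open>h\<close> in the direction \<open>g h\<close>.  As \<open>g\<close> carries the
coefficients, a finite set of points is all the further data needed.
\<close>

definition eval_comb :: "'k set \<Rightarrow> ('k \<Rightarrow> 'k ^ 'p) \<Rightarrow> nat \<Rightarrow> 'k::rc_field ^ 'p" where
  "eval_comb F g m = (\<Sum>h\<in>F. cj h ^ m *s g h)"

definition approximable :: "real \<Rightarrow> (nat \<Rightarrow> 'k::rc_field ^ 'p) \<Rightarrow> bool" where
  "approximable R \<Xi> \<longleftrightarrow>
     (\<forall>\<epsilon>>0. \<exists>F g. finite F \<and> geom_le R \<epsilon> (\<lambda>m. \<Xi> m - eval_comb F g m))"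

definition unit_seq :: "nat \<Rightarrow> 'k::rc_field ^ 'p \<Rightarrow> nat \<Rightarrow> 'k ^ 'p" where
  "unit_seq n e m = (if m = n then e else 0)"

lemma eval_comb_add:
  assumes "finite F" "finite F'"
  shows "eval_comb F g m + eval_comb F' g' m
    = eval_comb (F \<union> F') (\<lambda>h. (if h \<in> F then g h else 0) + (if h \<in> F' then g' h else 0)) m"
proof -
  have 1: "(\<Sum>h\<in>F. cj h ^ m *s g h) = (\<Sum>h\<in>F \<union> F'. cj h ^ m *s (if h \<in> F then g h else 0))"
    using assms by (intro sum.mono_neutral_cong_left) auto
  have 2: "(\<Sum>h\<in>F'. cj h ^ m *s g' h) = (\<Sum>h\<in>F \<union> F'. cj h ^ m *s (if h \<in> F' then g' h else 0))"
    using assms by (intro sum.mono_neutral_cong_left) auto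
  show ?thesis
    unfolding eval_comb_def 1 2 by (simp only: vector_add_ldistrib sum.distrib)
qed

lemma eval_comb_scale: "c *s eval_comb F g m = eval_comb F (\<lambda>h. c *s g h) m"
  unfolding eval_comb_def
  by (simp add: vec_eq_iff sum_distrib_left mult_ac)

lemma eval_comb_diff:
  assumes "finite F" "finite F'"
  shows "\<exists>G g''. finite G \<and> (\<forall>m. eval_comb F g m - eval_comb F' g' m = eval_comb G g'' m)"
proof -
  have "eval_comb F g m - eval_comb F' g' m = eval_comb F g m + eval_comb F' (\<lambda>h. (-1) *s g' h) m" for m
    unfolding eval_comb_scale[symmetric] by (simp add: vec_eq_iff)
  then have "\<forall>m. eval_comb F g m - eval_comb F' g' m = eval_comb (F \<union> F')
      (\<lambda>h. (if h \<in> F then g h else 0) + (if h \<in> F' then (-1) *s g' h else 0)) m"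
    by (simp only: eval_comb_add[OF assms]) simp
  then show ?thesis using assms by blast
qed

lemma approximable_limit:
  assumes "\<And>\<epsilon>. 0 < \<epsilon> \<Longrightarrow> \<exists>\<Theta>. approximable R \<Theta> \<and> geom_le R \<epsilon> (\<lambda>m. \<Xi> m - \<Theta> m)"
  shows "approximable R \<Xi>"
  unfolding approximable_def
proof (intro allI impI)
  fix \<epsilon> :: real assume "0 < \<epsilon>"
  then have e: "0 < \<epsilon>/2" by simp
  obtain \<Theta> where T: "approximable R \<Theta>" "geom_le R (\<epsilon>/2) (\<lambda>m. \<Xi> m - \<Theta> m)"
    using assms[OF e] by auto
  obtain F g where "finite F" "geom_le R (\<epsilon>/2) (\<lambda>m. \<Theta> m - eval_comb F g m)"
    using T(1) e unfolding approximable_def by blast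
  then show "\<exists>F g. finite F \<and> geom_le R \<epsilon> (\<lambda>m. \<Xi> m - eval_comb F g m)"
    using geom_le_add[OF T(2), of "\<epsilon>/2" "\<lambda>m. \<Theta> m - eval_comb F g m"] by auto
qed

lemma approximable_eval_comb:
  assumes "finite F" "0 \<le> R"
  shows "approximable R (eval_comb F g)"
  unfolding approximable_def
  using assms by (auto simp: geom_le_def intro!: exI[of _ F] exI[of _ g])

lemma approximable_add:
  assumes "approximable R \<Xi>" "approximable R \<Theta>"
  shows "approximable R (\<lambda>m. \<Xi> m + \<Theta> m)"
  unfolding approximable_def
proof (intro allI impI)
  fix \<epsilon> :: real assume "0 < \<epsilon>"
  then have e: "0 < \<epsilon>/2" by simp
  obtain F g where F: "finite F" "geom_le R (\<epsilon>/2) (\<lambda>m. \<Xi> m - eval_comb F g m)"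
    using assms(1) e unfolding approximable_def by blast
  obtain F' g' where F': "finite F'" "geom_le R (\<epsilon>/2) (\<lambda>m. \<Theta> m - eval_comb F' g' m)"
    using assms(2) e unfolding approximable_def by blast
  have "geom_le R \<epsilon> (\<lambda>m. (\<Xi> m + \<Theta> m) - (eval_comb F g m + eval_comb F' g' m))"
    using geom_le_add[OF F(2) F'(2)] by (simp add: algebra_simps)
  then show "\<exists>F g. finite F \<and> geom_le R \<epsilon> (\<lambda>m. \<Xi> m + \<Theta> m - eval_comb F g m)"
    unfolding eval_comb_add[OF F(1) F'(1)] using F(1) F'(1) by blast
qed

lemma approximable_scale:
  assumes "approximable R \<Xi>" "0 \<le> R"
  shows "approximable R (\<lambda>m. c *s \<Xi> m)"
  unfolding approximable_def
proof (intro allI impI)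
  fix \<epsilon> :: real assume "0 < \<epsilon>"
  then have e: "0 < \<epsilon> / (1 + norm c)" by (rule radius_pos)
  obtain F g where F: "finite F" "geom_le R (\<epsilon> / (1 + norm c)) (\<lambda>m. \<Xi> m - eval_comb F g m)"
    using assms(1) e unfolding approximable_def by blast
  have "norm c * (\<epsilon> / (1 + norm c)) \<le> \<epsilon>"
    using \<open>0 < \<epsilon>\<close> by (simp add: divide_simps add_pos_nonneg algebra_simps)
  then have "geom_le R \<epsilon> (\<lambda>m. c *s (\<Xi> m - eval_comb F g m))"
    using geom_le_mono[OF geom_le_scale[OF F(2), of c] assms(2)] by simp
  then have "geom_le R \<epsilon> (\<lambda>m. c *s \<Xi> m - eval_comb F (\<lambda>h. c *s g h) m)"
    by (simp add: vector_ssub_ldistrib eval_comb_scale)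
  then show "\<exists>F g. finite F \<and> geom_le R \<epsilon> (\<lambda>m. c *s \<Xi> m - eval_comb F g m)"
    using F(1) by blast
qed

lemma approximable_sum:
  assumes "\<And>k. k \<in> S \<Longrightarrow> approximable R (f k)" "finite S" "0 \<le> R"
  shows "approximable R (\<lambda>m. \<Sum>k\<in>S. f k m)"
  using assms(2,1)
proof (induction S rule: finite_induct)
  case empty
  then show ?case using approximable_eval_comb[of "{}" R] assms(3) by (simp add: eval_comb_def[abs_def])
next
  case (insert k S)
  then show ?case using approximable_add[of R "f k" "\<lambda>m. \<Sum>k\<in>S. f k m"] by simp
qed

text \<open>
The discrete form of the fact that derivatives at \<open>0\<close> are limits of combinations of evaluations:
removing from the evaluation sequence at a small \<open>t\<close> its first \<open>n\<close> terms, which are approximable by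
induction, and dividing by \<open>t ^ n\<close> leaves \<open>e\<close> at position \<open>n\<close> and terms of size at most \<open>t * norm e\<close>
beyond it.
\<close>

lemma approximable_unit_seq:
  fixes e :: "'k::rc_field ^ 'p"
  assumes "1 \<le> R"
  shows "approximable R (unit_seq n e)"
proof (induction n arbitrary: e rule: less_induct)
  case (less n)
  show ?case
  proof (rule approximable_limit)
    fix \<epsilon> :: real assume \<epsilon>: "0 < \<epsilon>"
    define t where "t = min 1 (\<epsilon> / (1 + norm e))"
    have t: "0 < t" "t \<le> 1" using \<epsilon> by (auto simp: t_def add_pos_nonneg)
    have "t * norm e \<le> (\<epsilon> / (1 + norm e)) * norm e"
      by (intro mult_right_mono) (auto simp: t_def)
    also have "\<dots> \<le> \<epsilon>"
      using \<epsilon> by (simp add: divide_simps add_pos_nonneg algebra_simps)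
    finally have te: "t * norm e \<le> \<epsilon>" .
    define \<Theta> where "\<Theta> m = of_real (1 / t ^ n) *s
      (eval_comb {of_real t} (\<lambda>_. e) m + (-1) *s (\<Sum>k<n. unit_seq k (of_real (t ^ k) *s e) m))" for m
    have "approximable R \<Theta>"
      unfolding \<Theta>_def
      using assms by (intro approximable_scale approximable_add approximable_eval_comb
          approximable_sum less.IH) auto
    moreover have "norm (unit_seq n e m - \<Theta> m) \<le> \<epsilon> * R ^ m" for m
    proof -
      have \<Theta>: "\<Theta> m = (if m < n then 0 else of_real (t ^ (m - n)) *s e)"
      proof (cases "m < n")
        case True
        then have "(\<Sum>k<n. unit_seq k (of_real (t ^ k) *s e) m) = of_real (t ^ m) *s e"
          by (simp add: unit_seq_def)
        then show ?thesis using True by (simp add: \<Theta>_def eval_comb_def cj_of_real vec_eq_iff)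
      next
        case False
        then have "(\<Sum>k<n. unit_seq k (of_real (t ^ k) *s e) m) = 0"
          by (intro sum.neutral) (auto simp: unit_seq_def)
        then show ?thesis using False t
          by (simp add: \<Theta>_def eval_comb_def cj_of_real vec_eq_iff power_diff)
      qed
      have "norm (unit_seq n e m - \<Theta> m) \<le> t * norm e"
      proof (cases "n < m")
        case True
        then have "t ^ (m - n) \<le> t ^ 1" using t by (intro power_decreasing) auto
        then show ?thesis using True t by (simp add: \<Theta> unit_seq_def norm_power mult_right_mono)
      next
        case False
        then show ?thesis using t by (auto simp: \<Theta> unit_seq_def)
      qed
      also have "\<dots> \<le> \<epsilon> * 1" using te by simp
      also have "\<dots> \<le> \<epsilon> * R ^ m"
        using one_le_power[OF assms] \<epsilon> by (intro mult_left_mono) auto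
      finally show ?thesis .
    qed
    ultimately show "\<exists>\<Theta>. approximable R \<Theta> \<and> geom_le R \<epsilon> (\<lambda>m. unit_seq n e m - \<Theta> m)"
      unfolding geom_le_def by blast
  qed
qed

text \<open>
Doubling the rate turns the tail into a small sequence, since the first \<open>M\<close> terms are gone and
\<open>R ^ m \<le> (1/2) ^ M * (2 * R) ^ m\<close> for the others.
\<close>

lemma truncation_error:
  assumes "geom_le R C \<Xi>" "0 \<le> R"
  shows "geom_le (2 * R) (C * (1/2) ^ M) (\<lambda>m. \<Xi> m - (\<Sum>k<M. unit_seq k (\<Xi> k) m))"
  unfolding geom_le_def
proof
  fix m
  have C: "0 \<le> C" using assms geom_le_const_nonneg by blast
  show "norm (\<Xi> m - (\<Sum>k<M. unit_seq k (\<Xi> k) m)) \<le> C * (1/2) ^ M * (2 * R) ^ m"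
  proof (cases "m < M")
    case True
    then have "(\<Sum>k<M. unit_seq k (\<Xi> k) m) = \<Xi> m" by (simp add: unit_seq_def)
    then show ?thesis using C assms by simp
  next
    case False
    then have "(\<Sum>k<M. unit_seq k (\<Xi> k) m) = 0"
      by (intro sum.neutral) (auto simp: unit_seq_def)
    then have "norm (\<Xi> m - (\<Sum>k<M. unit_seq k (\<Xi> k) m)) \<le> C * R ^ m"
      using geom_leD[OF assms(1)] by simp
    also have "\<dots> \<le> C * R ^ m * ((1/2) ^ M * 2 ^ m)"
    proof -
      have "(2::real) ^ M \<le> 2 ^ m" using False by (intro power_increasing) auto
      then have "1 \<le> (1/2) ^ M * (2::real) ^ m" by (simp add: power_one_over field_simps)
      then show ?thesis using C assms mult_left_mono[of 1 "(1/2) ^ M * 2 ^ m" "C * R ^ m"] by simp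
    qed
    finally show ?thesis by (simp add: power_mult_distrib mult_ac)
  qed
qed

lemma approximable_growth:
  assumes "geom_le R C \<Xi>" "1 \<le> R"
  shows "approximable (2 * R) \<Xi>"
proof (rule approximable_limit)
  fix \<epsilon> :: real assume \<epsilon>: "0 < \<epsilon>"
  have C: "0 \<le> C" using assms geom_le_const_nonneg by blast
  obtain M where M: "(1/2::real) ^ M < \<epsilon> / (1 + C)"
    using real_arch_pow_inv[of "\<epsilon> / (1 + C)" "1/2"] \<epsilon> C by auto
  have "C * (1/2) ^ M \<le> (1 + C) * (\<epsilon> / (1 + C))"
    using M C \<epsilon> by (intro mult_mono) auto
  then have "C * (1/2) ^ M \<le> \<epsilon>" using C by simp
  then have "geom_le (2 * R) \<epsilon> (\<lambda>m. \<Xi> m - (\<Sum>k<M. unit_seq k (\<Xi> k) m))"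
    using geom_le_mono[OF truncation_error[OF assms(1)]] assms(2) by simp
  moreover have "approximable (2 * R) (\<lambda>m. \<Sum>k<M. unit_seq k (\<Xi> k) m)"
    using assms by (intro approximable_sum approximable_unit_seq) auto
  ultimately show "\<exists>\<Theta>. approximable (2 * R) \<Theta> \<and> geom_le (2 * R) \<epsilon> (\<lambda>m. \<Xi> m - \<Theta> m)"
    by blast
qed

lemma eval_comb_sequence:
  assumes "geom_le R C \<Xi>" "1 \<le> R"
  obtains F g where "\<And>s. finite (F s)"
    "\<And>s. geom_le (2 * R) (1 / of_nat (Suc s)) (\<lambda>m. \<Xi> m - eval_comb (F s) (g s) m)"
proof -
  have "\<forall>s. \<exists>F g. finite F \<and> geom_le (2 * R) (1 / of_nat (Suc s)) (\<lambda>m. \<Xi> m - eval_comb F g m)"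
    using approximable_growth[OF assms] unfolding approximable_def by simp
  then show ?thesis using that by metis
qed

section \<open>The sesquilinear form of the coefficient matrix\<close>

definition geom_growth :: "(nat \<Rightarrow> 'a::real_normed_vector) \<Rightarrow> bool" where
  "geom_growth \<Xi> \<longleftrightarrow> (\<exists>R\<ge>1. \<exists>C. geom_le R C \<Xi>)"

lemma geom_growthI: "geom_le R C \<Xi> \<Longrightarrow> 0 \<le> R \<Longrightarrow> geom_growth \<Xi>"
  unfolding geom_growth_def using geom_le_mono[of R C \<Xi> "max 1 R" C]
  by (intro exI[of _ "max 1 R"] exI[of _ C]) auto

lemma geom_growth_common:
  assumes "geom_growth \<Xi>" "geom_growth \<Theta>"
  obtains R C where "1 \<le> R" "geom_le R C \<Xi>" "geom_le R C \<Theta>"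
proof -
  obtain R1 C1 where 1: "1 \<le> R1" "geom_le R1 C1 \<Xi>" using assms(1) by (auto simp: geom_growth_def)
  obtain R2 C2 where 2: "1 \<le> R2" "geom_le R2 C2 \<Theta>" using assms(2) by (auto simp: geom_growth_def)
  show ?thesis
    using 1 2 by (intro that[of "max R1 R2" "max C1 C2"] geom_le_mono[OF 1(2)] geom_le_mono[OF 2(2)]) auto
qed

lemma geom_growth_add: "geom_growth \<Xi> \<Longrightarrow> geom_growth \<Theta> \<Longrightarrow> geom_growth (\<lambda>m. \<Xi> m + \<Theta> m)"
  by (erule (1) geom_growth_common) (auto simp: geom_growth_def intro: geom_le_add)

lemma geom_growth_diff: "geom_growth \<Xi> \<Longrightarrow> geom_growth \<Theta> \<Longrightarrow> geom_growth (\<lambda>m. \<Xi> m - \<Theta> m)"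
  by (erule (1) geom_growth_common) (auto simp: geom_growth_def intro: geom_le_diff)

lemma geom_growth_scale: "geom_growth \<Xi> \<Longrightarrow> geom_growth (\<lambda>m. (c::'k::rc_field) *s (\<Xi> m :: 'k ^ 'p))"
  unfolding geom_growth_def by (blast intro: geom_le_scale)

lemma geom_growth_0: "geom_growth (\<lambda>m. 0)"
  by (rule geom_growthI[of 1 0]) (auto simp: geom_le_def)

lemma geom_growth_sum:
  "(\<And>x. x \<in> S \<Longrightarrow> geom_growth (f x)) \<Longrightarrow> geom_growth (\<lambda>m. \<Sum>x\<in>S. f x m)"
  by (induction S rule: infinite_finite_induct) (auto intro: geom_growth_add geom_growth_0)

lemma geom_growth_eval: "geom_growth (\<lambda>m. cj w ^ m *s (e :: 'k::rc_field ^ 'p))"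
  by (rule geom_growthI[of "norm w" "norm e"]) (auto simp: geom_le_def norm_power)

lemma geom_growth_eval_comb: "geom_growth (eval_comb F g)"
  unfolding eval_comb_def[abs_def] by (rule geom_growth_sum) (rule geom_growth_eval)

lemma geom_growth_unit_seq: "geom_growth (unit_seq n e)"
  by (rule geom_growthI[of 1 "norm e"]) (auto simp: geom_le_def unit_seq_def)

lemma geom_growth_cotaylor:
  assumes "\<And>n. norm (\<xi> n) \<le> X"
  shows "geom_growth (cotaylor w \<xi>)"
  by (rule geom_growthI[OF cotaylor_growth[of \<xi>, OF assms]]) (simp add: add_nonneg_nonneg)

context entire_expansion
begin

definition form :: "(nat \<Rightarrow> 'k ^ 'p) \<Rightarrow> (nat \<Rightarrow> 'k ^ 'p) \<Rightarrow> 'k" where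
  "form \<Xi> \<Theta> = ell2_inner (block_op A \<Xi>) \<Theta>"

text \<open>
The function represented by \<open>\<Xi>\<close>: evaluation sequences represent kernel functions
(\<open>kernel_series_eval\<close>), and unit sequences their coefficients in powers of \<open>cj w\<close>.
\<close>

definition kernel_series :: "(nat \<Rightarrow> 'k ^ 'p) \<Rightarrow> 'k \<Rightarrow> 'k ^ 'p" where
  "kernel_series \<Xi> z = (\<Sum>n. z ^ n *s block_op A \<Xi> n)"

lemma form_bound:
  assumes R: "0 < R"
  obtains D where "0 \<le> D"
    and "\<And>C C' \<Xi> \<Theta>. geom_le R C \<Xi> \<Longrightarrow> geom_le R C' \<Theta> \<Longrightarrow> norm (form \<Xi> \<Theta>) \<le> D * C * C'"
    and "\<And>C C' \<Xi> \<Theta>. geom_le R C \<Xi> \<Longrightarrow> geom_le R C' \<Theta> \<Longrightarrow>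
           summable (\<lambda>n. vinner (block_op A \<Xi> n) (\<Theta> n))"
proof -
  have r: "0 < 1/2 / R" using R by simp
  obtain D where D: "0 \<le> D"
    "\<And>C \<Xi>. geom_le R C \<Xi> \<Longrightarrow> geom_le (1/2 / R) (D * C) (block_op A \<Xi>)"
    by (rule block_op_bounds[OF r R]) (rule that; assumption)
  have bd: "norm (vinner (block_op A \<Xi> n) (\<Theta> n)) \<le> D * C * C' * (1/2) ^ n"
    if "geom_le R C \<Xi>" "geom_le R C' \<Theta>" for C C' \<Xi> \<Theta> n
  proof -
    have "norm (vinner (block_op A \<Xi> n) (\<Theta> n)) \<le> norm (block_op A \<Xi> n) * norm (\<Theta> n)"
      by (rule norm_vinner_le)
    also have "\<dots> \<le> (D * C * (1/2 / R) ^ n) * (C' * R ^ n)"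
      using D(1) R geom_le_const_nonneg[OF that(1)]
      by (intro mult_mono geom_leD[OF D(2)[OF that(1)]] geom_leD[OF that(2)]) auto
    also have "\<dots> = D * C * C' * (1/2) ^ n" using R by (simp add: power_divide)
    finally show ?thesis .
  qed
  show ?thesis
  proof (rule that[of "2 * D"])
    show "0 \<le> 2 * D" using D by simp
    show "norm (form \<Xi> \<Theta>) \<le> 2 * D * C * C'" if "geom_le R C \<Xi>" "geom_le R C' \<Theta>" for C C' \<Xi> \<Theta>
      using half_powers_bound(3)[OF bd[OF that]] by (simp add: form_def ell2_inner_def mult.assoc)
    show "summable (\<lambda>n. vinner (block_op A \<Xi> n) (\<Theta> n))" if "geom_le R C \<Xi>" "geom_le R C' \<Theta>" for C C' \<Xi> \<Theta>
      using half_powers_bound(2)[OF bd[OF that]] .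
  qed
qed

lemma form_summable:
  assumes "geom_growth \<Xi>" "geom_growth \<Theta>"
  shows "summable (\<lambda>n. vinner (block_op A \<Xi> n) (\<Theta> n))"
proof -
  obtain R C where R: "1 \<le> R" "geom_le R C \<Xi>" "geom_le R C \<Theta>"
    using geom_growth_common[OF assms] by metis
  then have "0 < R" by simp
  then show ?thesis using form_bound[of R] R by metis
qed

lemma growth_block_summable: "geom_growth \<Xi> \<Longrightarrow> summable (\<lambda>m. A n m *v \<Xi> m)"
  unfolding geom_growth_def using block_summable by (metis less_le_trans zero_less_one)

lemma block_op_add:
  assumes "geom_growth \<Xi>" "geom_growth \<Theta>"
  shows "block_op A (\<lambda>m. \<Xi> m + \<Theta> m) n = block_op A \<Xi> n + block_op A \<Theta> n"
  unfolding block_op_def matrix_vector_right_distrib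
  by (rule suminf_add[symmetric]) (intro growth_block_summable assms)+

lemma block_op_scale:
  assumes "geom_growth \<Xi>"
  shows "block_op A (\<lambda>m. c *s \<Xi> m) n = c *s block_op A \<Xi> n"
  unfolding block_op_def vector_scalar_commute
  by (rule bounded_linear.suminf[OF bounded_linear_vector_scalar, symmetric])
     (rule growth_block_summable[OF assms])

lemma form_add_left:
  assumes "geom_growth \<Xi>" "geom_growth \<Xi>'" "geom_growth \<Theta>"
  shows "form (\<lambda>m. \<Xi> m + \<Xi>' m) \<Theta> = form \<Xi> \<Theta> + form \<Xi>' \<Theta>"
  unfolding form_def ell2_inner_def block_op_add[OF assms(1,2)] vinner_add_left
  by (rule suminf_add[symmetric]) (intro form_summable assms)+

lemma form_add_right:
  assumes "geom_growth \<Xi>" "geom_growth \<Theta>" "geom_growth \<Theta>'"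
  shows "form \<Xi> (\<lambda>m. \<Theta> m + \<Theta>' m) = form \<Xi> \<Theta> + form \<Xi> \<Theta>'"
  unfolding form_def ell2_inner_def vinner_add_right
  by (rule suminf_add[symmetric]) (intro form_summable assms)+

lemma form_scale_left:
  assumes "geom_growth \<Xi>" "geom_growth \<Theta>"
  shows "form (\<lambda>m. c *s \<Xi> m) \<Theta> = c * form \<Xi> \<Theta>"
  unfolding form_def ell2_inner_def block_op_scale[OF assms(1)] vinner_scale_left
  by (rule suminf_mult) (intro form_summable assms)

lemma form_scale_right:
  assumes "geom_growth \<Xi>" "geom_growth \<Theta>"
  shows "form \<Xi> (\<lambda>m. c *s \<Theta> m) = cj c * form \<Xi> \<Theta>"
  unfolding form_def ell2_inner_def vinner_scale_right
  by (rule suminf_mult) (intro form_summable assms)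

lemma form_0 [simp]: "form (\<lambda>m. 0) \<Theta> = 0" "form \<Xi> (\<lambda>m. 0) = 0"
  by (simp_all add: form_def ell2_inner_def block_op_def)

lemma form_sum_left:
  assumes "\<And>x. x \<in> S \<Longrightarrow> geom_growth (f x)" "geom_growth \<Theta>"
  shows "form (\<lambda>m. \<Sum>x\<in>S. f x m) \<Theta> = (\<Sum>x\<in>S. form (f x) \<Theta>)"
  using assms by (induction S rule: infinite_finite_induct) (auto simp: form_add_left geom_growth_sum)

lemma form_sum_right:
  assumes "\<And>x. x \<in> S \<Longrightarrow> geom_growth (f x)" "geom_growth \<Xi>"
  shows "form \<Xi> (\<lambda>m. \<Sum>x\<in>S. f x m) = (\<Sum>x\<in>S. form \<Xi> (f x))"
  using assms by (induction S rule: infinite_finite_induct) (auto simp: form_add_right geom_growth_sum)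

lemma form_diff_left:
  assumes "geom_growth \<Xi>" "geom_growth \<Xi>'" "geom_growth \<Theta>"
  shows "form (\<lambda>m. \<Xi> m - \<Xi>' m) \<Theta> = form \<Xi> \<Theta> - form \<Xi>' \<Theta>"
  using form_add_left[OF geom_growth_diff[OF assms(1,2)] assms(2,3)] by simp

lemma form_diff_right:
  assumes "geom_growth \<Xi>" "geom_growth \<Theta>" "geom_growth \<Theta>'"
  shows "form \<Xi> (\<lambda>m. \<Theta> m - \<Theta>' m) = form \<Xi> \<Theta> - form \<Xi> \<Theta>'"
  using form_add_right[OF assms(1) geom_growth_diff[OF assms(2,3)] assms(3)] by simp

text \<open>
Continuity of a bounded sesquilinear form, with \<open>\<delta> s\<close> bounding the distances in the weighted sup norm.
\<close>

lemma form_tendsto: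
  assumes R: "0 < R" and \<Xi>: "geom_le R C \<Xi>" and \<Theta>: "geom_le R C \<Theta>"
    and X: "\<And>s. geom_le R (\<delta> s) (\<lambda>m. \<Xi> m - X s m)"
    and Y: "\<And>s. geom_le R (\<delta> s) (\<lambda>m. \<Theta> m - Y s m)"
    and \<delta>: "\<delta> \<longlonglongrightarrow> 0"
  shows "(\<lambda>s. form (X s) (Y s)) \<longlonglongrightarrow> form \<Xi> \<Theta>"
proof -
  obtain D where D: "0 \<le> D"
    "\<And>C C' \<Xi> \<Theta>. geom_le R C \<Xi> \<Longrightarrow> geom_le R C' \<Theta> \<Longrightarrow> norm (form \<Xi> \<Theta>) \<le> D * C * C'"
    by (rule form_bound[OF R]) (rule that; assumption)
  have XX: "geom_le R (C + \<delta> s) (X s)" and YY: "geom_le R (C + \<delta> s) (Y s)" for s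
    using geom_le_diff[OF \<Xi> X[of s]] geom_le_diff[OF \<Theta> Y[of s]] by simp_all
  note g = geom_growthI[OF _ less_imp_le[OF R]]
  have "norm (form (X s) (Y s) - form \<Xi> \<Theta>) \<le> D * \<delta> s * (C + \<delta> s) + D * C * \<delta> s" for s
  proof -
    have "form (X s) (Y s) - form \<Xi> \<Theta>
        = - (form (\<lambda>m. \<Xi> m - X s m) (Y s) + form \<Xi> (\<lambda>m. \<Theta> m - Y s m))"
      using form_diff_left[OF g[OF \<Xi>] g[OF XX[of s]] g[OF YY[of s]]]
        form_diff_right[OF g[OF \<Xi>] g[OF \<Theta>] g[OF YY[of s]]]
      by simp
    then have "norm (form (X s) (Y s) - form \<Xi> \<Theta>)
        = norm (form (\<lambda>m. \<Xi> m - X s m) (Y s) + form \<Xi> (\<lambda>m. \<Theta> m - Y s m))"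
      by (simp only: norm_minus_cancel)
    also have "\<dots> \<le> D * \<delta> s * (C + \<delta> s) + D * C * \<delta> s"
      by (rule norm_triangle_mono[OF D(2)[OF X[of s] YY[of s]] D(2)[OF \<Xi> Y[of s]]])
    finally show ?thesis .
  qed
  then have "\<forall>\<^sub>F s in sequentially. norm (form (X s) (Y s) - form \<Xi> \<Theta>)
      \<le> D * \<delta> s * (C + \<delta> s) + D * C * \<delta> s"
    by (intro always_eventually allI)
  moreover have "(\<lambda>s. D * \<delta> s * (C + \<delta> s) + D * C * \<delta> s) \<longlonglongrightarrow> D * 0 * (C + 0) + D * C * 0"
    by (intro tendsto_intros \<delta>)
  then have "(\<lambda>s. D * \<delta> s * (C + \<delta> s) + D * C * \<delta> s) \<longlonglongrightarrow> 0" by simp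
  ultimately have "(\<lambda>s. form (X s) (Y s) - form \<Xi> \<Theta>) \<longlonglongrightarrow> 0"
    by (rule Lim_null_comparison)
  then show ?thesis by (simp add: LIM_zero_iff)
qed

lemma kernel_series_summable:
  assumes "geom_growth \<Xi>"
  shows "summable (\<lambda>n. z ^ n *s block_op A \<Xi> n)"
proof -
  obtain R C where R: "1 \<le> R" "geom_le R C \<Xi>" using assms by (auto simp: geom_growth_def)
  then have R0: "0 < R" by simp
  obtain D where "\<And>C \<Xi>. geom_le R C \<Xi> \<Longrightarrow> geom_le (1/2 / (1 + norm z)) (D * C) (block_op A \<Xi>)"
    by (rule block_op_bounds[OF half_radius_pos[of z] R0]) (rule that; assumption)
  from this[OF R(2)] have D: "geom_le (1/2 / (1 + norm z)) (D * C) (block_op A \<Xi>)" .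
  show ?thesis
  proof (rule half_powers_bound(2))
    fix n
    have "norm (z ^ n *s block_op A \<Xi> n) \<le> (1 + norm z) ^ n * (D * C * (1/2 / (1 + norm z)) ^ n)"
      using geom_leD[OF D] by (auto simp: norm_power intro!: mult_mono power_mono)
    also have "\<dots> = D * C * (1/2) ^ n"
      unfolding radius_power[of "1/2" z n, symmetric] by (simp only: mult_ac)
    finally show "norm (z ^ n *s block_op A \<Xi> n) \<le> D * C * (1/2) ^ n" .
  qed
qed

lemma kernel_series_nth_sums:
  assumes "geom_growth \<Xi>"
  shows "(\<lambda>n. block_op A \<Xi> n $ i * z ^ n) sums kernel_series \<Xi> z $ i"
  using bounded_linear.sums[OF bounded_linear_vec_nth summable_sums[OF kernel_series_summable[OF assms, of z]], of i]
  by (simp add: kernel_series_def mult.commute)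

text \<open>
The reproducing property at the level of sequences.
\<close>

lemma form_eval:
  assumes "geom_growth \<Xi>"
  shows "form \<Xi> (\<lambda>m. cj z ^ m *s e) = vinner (kernel_series \<Xi> z) e"
proof -
  have "form \<Xi> (\<lambda>m. cj z ^ m *s e) = (\<Sum>n. vinner (z ^ n *s block_op A \<Xi> n) e)"
    by (simp add: form_def ell2_inner_def vinner_scale_right vinner_scale_left cj_power)
  also have "\<dots> = vinner (kernel_series \<Xi> z) e"
    unfolding kernel_series_def
    by (rule bounded_linear.suminf[OF bounded_linear_vinner_left, symmetric])
       (rule kernel_series_summable[OF assms])
  finally show ?thesis .
qed

lemma form_eval_comb:
  assumes "geom_growth \<Xi>"
  shows "form \<Xi> (eval_comb F g) = (\<Sum>h\<in>F. vinner (kernel_series \<Xi> h) (g h))"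
  unfolding eval_comb_def[abs_def]
  by (simp add: form_sum_right geom_growth_eval assms form_eval)

lemma kernel_series_eval: "kernel_series (\<lambda>m. cj w ^ m *s e) z = K z w *v e"
proof -
  \<comment> \<open>The entry at \<open>(0, 0)\<close> of the Taylor block is \<open>K z w\<close> itself, so the factorisation of the
    Taylor operator at the unit sequence at \<open>0\<close> already contains the claim.\<close>
  have co: "cotaylor w (unit_seq 0 e) = (\<lambda>m. cj w ^ m *s e)"
  proof
    fix m
    have "cotaylor w (unit_seq 0 e) m
        = (\<Sum>n\<le>m. if n = 0 then (of_nat (m choose n) * cj w ^ (m - n)) *s e else 0)"
      unfolding cotaylor_def by (rule sum.cong) (auto simp: unit_seq_def)
    then show "cotaylor w (unit_seq 0 e) m = cj w ^ m *s e" by simp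
  qed
  have b: "norm (unit_seq 0 e n) \<le> norm e" for n by (simp add: unit_seq_def)
  have "taylor_op K z w (unit_seq 0 e) 0 = (\<Sum>m\<in>{0}. taylor_block K z w 0 m *v unit_seq 0 e m)"
    unfolding taylor_op_def block_op_def by (rule suminf_finite) (auto simp: unit_seq_def)
  also have "\<dots> = K z w *v e"
    by (simp add: unit_seq_def taylor_block_def vec_lambda_eta)
  finally have T: "taylor_op K z w (unit_seq 0 e) 0 = K z w *v e" .
  have "(K z w *v e) $ i = kernel_series (\<lambda>m. cj w ^ m *s e) z $ i" for i
    using taylor_op_factor(2)[of "unit_seq 0 e", OF b, of z w 0 i] 
      kernel_series_nth_sums[OF geom_growth_eval, of w e i z]
    by (simp add: T co taylor_shift_def sums_iff mult.commute)
  then show ?thesis by (simp add: vec_eq_iff)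
qed

lemma kernel_series_sum:
  assumes "\<And>x. x \<in> S \<Longrightarrow> geom_growth (f x)"
  shows "kernel_series (\<lambda>m. \<Sum>x\<in>S. f x m) z = (\<Sum>x\<in>S. kernel_series (f x) z)"
  by (rule vinner_eqI)
     (simp add: form_eval[symmetric] vinner_sum_left form_sum_left geom_growth_eval geom_growth_sum assms)

lemma kernel_series_diff:
  assumes "geom_growth \<Xi>" "geom_growth \<Theta>"
  shows "kernel_series (\<lambda>m. \<Xi> m - \<Theta> m) z = kernel_series \<Xi> z - kernel_series \<Theta> z"
  by (rule vinner_eqI)
     (simp add: form_eval[symmetric] vinner_diff_left form_diff_left geom_growth_eval geom_growth_diff assms)

lemma kernel_series_scale:
  assumes "geom_growth \<Xi>"
  shows "kernel_series (\<lambda>m. c *s \<Xi> m) z = c *s kernel_series \<Xi> z"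
  by (rule vinner_eqI)
     (simp add: form_eval[symmetric] vinner_scale_left form_scale_left geom_growth_eval geom_growth_scale assms)

lemma kernel_series_eval_comb: "kernel_series (eval_comb F g) z = (\<Sum>h\<in>F. K z h *v g h)"
  unfolding eval_comb_def[abs_def]
  by (simp add: kernel_series_sum geom_growth_eval kernel_series_eval)

lemma form_eval_comb_eval_comb:
  "form (eval_comb F g) (eval_comb F' g') = (\<Sum>h'\<in>F'. \<Sum>h\<in>F. vinner (K h' h *v g h) (g' h'))"
  by (simp add: form_eval_comb geom_growth_eval_comb kernel_series_eval_comb vinner_sum_left)

text \<open>
Density and continuity combined, with the three limits from one choice of approximants, as needed for
comparing \<open>form \<Xi> \<Theta>\<close> with \<open>form \<Theta> \<Xi>\<close> and for positivity on the diagonal.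
\<close>

lemma form_as_limit:
  assumes "geom_growth \<Xi>" "geom_growth \<Theta>"
  obtains F g F' g' where "\<And>s::nat. finite (F s)" "\<And>s::nat. finite (F' s)"
    "(\<lambda>s. form (eval_comb (F s) (g s)) (eval_comb (F' s) (g' s))) \<longlonglongrightarrow> form \<Xi> \<Theta>"
    "(\<lambda>s. form (eval_comb (F' s) (g' s)) (eval_comb (F s) (g s))) \<longlonglongrightarrow> form \<Theta> \<Xi>"
    "(\<lambda>s. form (eval_comb (F s) (g s)) (eval_comb (F s) (g s))) \<longlonglongrightarrow> form \<Xi> \<Xi>"
proof -
  obtain R C where R: "1 \<le> R" "geom_le R C \<Xi>" "geom_le R C \<Theta>"
    using geom_growth_common[OF assms] by metis
  obtain F g where F: "\<And>s. finite (F s)"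
    "\<And>s. geom_le (2 * R) (1 / of_nat (Suc s)) (\<lambda>m. \<Xi> m - eval_comb (F s) (g s) m)"
    using eval_comb_sequence[OF R(2,1)] by metis
  obtain F' g' where F': "\<And>s. finite (F' s)"
    "\<And>s. geom_le (2 * R) (1 / of_nat (Suc s)) (\<lambda>m. \<Theta> m - eval_comb (F' s) (g' s) m)"
    using eval_comb_sequence[OF R(3,1)] by metis
  have b: "geom_le (2 * R) C \<Xi>" "geom_le (2 * R) C \<Theta>"
    using R by (auto intro: geom_le_mono)
  have p: "0 < 2 * R" using R by simp
  have l: "(\<lambda>s. 1 / real (Suc s)) \<longlonglongrightarrow> 0" by (rule LIMSEQ_Suc[OF lim_1_over_n])
  show ?thesis
    by (rule that[OF F(1) F'(1) form_tendsto[OF p b(1,2) F(2) F'(2) l] form_tendsto[OF p b(2,1) F'(2) F(2) l]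
          form_tendsto[OF p b(1,1) F(2) F(2) l]])
qed

text \<open>
Between combinations of evaluation sequences the form is a finite sum of kernel values, where the
symmetry of the kernel applies; the general case is a limit.
\<close>

lemma form_hermitian:
  assumes herm: "\<And>z w e f. vinner (K w z *v f) e = cj (vinner (K z w *v e) f)"
    and "geom_growth \<Xi>" "geom_growth \<Theta>"
  shows "form \<Theta> \<Xi> = cj (form \<Xi> \<Theta>)"
proof -
  obtain F g F' g' where lim:
    "(\<lambda>s::nat. form (eval_comb (F s) (g s)) (eval_comb (F' s) (g' s))) \<longlonglongrightarrow> form \<Xi> \<Theta>"
    "(\<lambda>s. form (eval_comb (F' s) (g' s)) (eval_comb (F s) (g s))) \<longlonglongrightarrow> form \<Theta> \<Xi>"
    by (rule form_as_limit[OF assms(2,3)]) (rule that; assumption)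
  have sym: "cj (form (eval_comb F g) (eval_comb F' g')) = form (eval_comb F' g') (eval_comb F g)" for F g F' g'
    unfolding form_eval_comb_eval_comb cj_sum herm[symmetric] by (rule sum.swap[symmetric])
  have "(\<lambda>s. cj (form (eval_comb (F s) (g s)) (eval_comb (F' s) (g' s)))) \<longlonglongrightarrow> form \<Theta> \<Xi>"
    unfolding sym by (rule lim(2))
  moreover have "(\<lambda>s. cj (form (eval_comb (F s) (g s)) (eval_comb (F' s) (g' s)))) \<longlonglongrightarrow> cj (form \<Xi> \<Theta>)"
    by (rule bounded_linear.tendsto[OF bounded_linear_cj lim(1)])
  ultimately show ?thesis by (rule LIMSEQ_unique)
qed

text \<open>
For a combination of evaluation sequences this is the positivity of the kernel at the finite set of pairs
\<open>(h, g h)\<close> with all scalar weights equal to \<open>1\<close>, and nonnegativity survives the limit.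
\<close>

lemma form_nonneg:
  assumes pd: "positive_definite_matrix_kernel K" and "geom_growth \<Xi>"
  shows "form \<Xi> \<Xi> \<in> \<real>\<^sub>\<ge>\<^sub>0"
proof -
  obtain F g where F: "\<And>s::nat. finite (F s)" and
    lim: "(\<lambda>s::nat. form (eval_comb (F s) (g s)) (eval_comb (F s) (g s))) \<longlonglongrightarrow> form \<Xi> \<Xi>"
    by (rule form_as_limit[OF assms(2,2)]) (rule that; assumption)
  have "form (eval_comb F g) (eval_comb F g) \<in> \<real>\<^sub>\<ge>\<^sub>0" if "finite F" for F g
  proof -
    define S where "S = (\<lambda>h. (h, g h)) ` F"
    have inj: "inj_on (\<lambda>h. (h, g h)) F" by (rule inj_onI) simp
    have "(\<Sum>x\<in>S. \<Sum>y\<in>S. cj 1 * (\<lambda>(z, f) (w, e). vinner (K z w *v e) f) x y * 1) \<in> \<real>\<^sub>\<ge>\<^sub>0"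
    proof -
      have "\<forall>S c. finite S \<longrightarrow> S \<subseteq> UNIV \<times> UNIV \<longrightarrow>
          (\<Sum>x\<in>S. \<Sum>y\<in>S. cj (c x) * (\<lambda>(z, f) (w, e). vinner (K z w *v e) f) x y * c y) \<in> \<real>\<^sub>\<ge>\<^sub>0"
        using pd unfolding positive_definite_matrix_kernel_def positive_definite_kernel_def
          psd_scalar_kernel_def by (rule conjunct2)
      from this[rule_format, of S "\<lambda>_. 1"] show ?thesis using that by (simp add: S_def)
    qed
    then show ?thesis
      by (simp add: S_def sum.reindex[OF inj] form_eval_comb_eval_comb)
  qed
  then show ?thesis
    using closed_sequentially[OF closed_nonneg_Reals _ lim] F by blast
qed

lemma taylor_op_bounds:
  obtains D where "0 \<le> D"
    and "\<And>\<xi> X. (\<And>n. norm (\<xi> n) \<le> X) \<Longrightarrow> geom_le (1/4) (D * X) (taylor_op K z w \<xi>)"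
proof -
  have w: "0 < 1 + norm w" by (simp add: add_pos_nonneg)
  obtain D where D: "0 \<le> D"
    "\<And>C \<Xi>. geom_le (1 + norm w) C \<Xi> \<Longrightarrow> geom_le (1/4 / (1 + norm z)) (D * C) (block_op A \<Xi>)"
    by (rule block_op_bounds[OF quarter_radius_pos[of z] w]) (rule that; assumption)
  show ?thesis
  proof (rule that[of "of_nat CARD('p) * (2 * D)"])
    fix \<xi> :: "nat \<Rightarrow> 'k ^ 'p" and X assume \<xi>: "norm (\<xi> n) \<le> X" for n
    show "geom_le (1/4) (of_nat CARD('p) * (2 * D) * X) (taylor_op K z w \<xi>)"
      using vector_taylor_shift_bound[OF D(2)[OF cotaylor_growth[of \<xi>, OF \<xi>]]
          taylor_op_factor(2)[of \<xi>, OF \<xi>]]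
      by (simp add: mult.assoc)
  qed (use D in simp)
qed

text \<open>
Compresses the whole family of Taylor operators into one form: the points \<open>z\<close> and \<open>w\<close> only act on the
arguments.
\<close>

lemma taylor_op_inner:
  assumes \<xi>: "\<And>n. norm (\<xi> n) \<le> X" and \<eta>: "\<And>n. norm (\<eta> n) \<le> Y"
  shows "ell2_inner (taylor_op K z w \<xi>) \<eta> = form (cotaylor w \<xi>) (cotaylor z \<eta>)"
    and "summable (\<lambda>n. vinner (taylor_op K z w \<xi> n) (\<eta> n))"
proof -
  have w: "0 < 1 + norm w" by (simp add: add_pos_nonneg)
  obtain D where "\<And>C \<Xi>. geom_le (1 + norm w) C \<Xi> \<Longrightarrow>
      geom_le (1/4 / (1 + norm z)) (D * C) (block_op A \<Xi>)"
    by (rule block_op_bounds[OF quarter_radius_pos[of z] w]) (rule that; assumption)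
  from this[OF cotaylor_growth[of \<xi>, OF \<xi>]]
  have B: "geom_le (1/4 / (1 + norm z)) (D * X) (block_op A (cotaylor w \<xi>))" .
  show "ell2_inner (taylor_op K z w \<xi>) \<eta> = form (cotaylor w \<xi>) (cotaylor z \<eta>)"
    and "summable (\<lambda>n. vinner (taylor_op K z w \<xi> n) (\<eta> n))"
    unfolding form_def
    by (rule vector_taylor_adjoint[of z "D * X" "block_op A (cotaylor w \<xi>)" \<eta> Y "taylor_op K z w \<xi>",
          OF B \<eta> taylor_op_factor(2)[of \<xi>, OF \<xi>]])+
qed

end

section \<open>Boundedness, symmetry and positivity of the Taylor operator\<close>

lemma ell2_inner_self:
  assumes "\<xi> \<in> ell2"
  shows "ell2_inner \<xi> \<xi> = of_real (\<Sum>n. (norm (\<xi> n))\<^sup>2)"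
  using assms unfolding ell2_inner_def vinner_self ell2_def
  by (simp add: suminf_of_real)

lemma ip_norm_ell2:
  assumes "\<xi> \<in> ell2"
  shows "ip_norm ell2_inner \<xi> = sqrt (\<Sum>n. (norm (\<xi> n))\<^sup>2)"
  using assms by (simp add: ip_norm_def ell2_inner_self ell2_def suminf_nonneg)

lemma norm_le_ip_norm_ell2:
  assumes "\<xi> \<in> ell2"
  shows "norm (\<xi> n) \<le> ip_norm ell2_inner \<xi>"
proof -
  have "(\<Sum>k\<in>{n}. (norm (\<xi> k))\<^sup>2) \<le> (\<Sum>n. (norm (\<xi> n))\<^sup>2)"
    using assms by (intro sum_le_suminf) (auto simp: ell2_def)
  then show ?thesis by (simp add: ip_norm_ell2[OF assms] real_le_rsqrt)
qed

text \<open>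
The operators below take values in geometrically decaying sequences, so their boundedness in
\<open>ell2\<close> is immediate from a sup bound.
\<close>

lemma geom_le_ell2:
  assumes "geom_le (1/4) B \<xi>"
  shows "\<xi> \<in> ell2" and "ip_norm ell2_inner \<xi> \<le> 2 * B"
proof -
  have B: "0 \<le> B" using assms geom_le_const_nonneg by blast
  have "norm ((norm (\<xi> n))\<^sup>2) \<le> B\<^sup>2 * (1/2) ^ n" for n
  proof -
    have "(norm (\<xi> n))\<^sup>2 \<le> (B * (1/4) ^ n)\<^sup>2"
      using geom_leD[OF assms, of n] by (intro power_mono) auto
    also have "\<dots> = B\<^sup>2 * (1/16) ^ n"
      by (simp add: power_mult_distrib power2_eq_square flip: power_mult_distrib)
    also have "\<dots> \<le> B\<^sup>2 * (1/2) ^ n" by (intro mult_left_mono power_mono) auto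
    finally show ?thesis by simp
  qed
  from half_powers_bound[OF this]
  have s: "summable (\<lambda>n. (norm (\<xi> n))\<^sup>2)" and sum: "(\<Sum>n. (norm (\<xi> n))\<^sup>2) \<le> 2 * B\<^sup>2"
    by auto
  have "2 * B\<^sup>2 \<le> (2 * B)\<^sup>2" by (simp add: power_mult_distrib)
  with sum have "(\<Sum>n. (norm (\<xi> n))\<^sup>2) \<le> (2 * B)\<^sup>2" by linarith
  then show "\<xi> \<in> ell2" "ip_norm ell2_inner \<xi> \<le> 2 * B"
    using s B by (auto simp: ell2_def ip_norm_ell2 real_le_lsqrt)
qed

lemma (in entire_expansion) taylor_block_bounded: "defines_bounded_operator (taylor_block K z w)"
proof -
  obtain D where D: "0 \<le> D"
    "\<And>\<xi> X. (\<And>n. norm (\<xi> n) \<le> X) \<Longrightarrow> geom_le (1/4) (D * X) (taylor_op K z w \<xi>)"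
    by (rule taylor_op_bounds[of z w]) (rule that; blast)
  have sm: "summable (\<lambda>m. taylor_block K z w n m *v \<xi> m)" if "\<xi> \<in> ell2" for \<xi> n
    by (rule taylor_op_factor(1)) (rule norm_le_ip_norm_ell2[OF that])
  have "bounded_operator_on ell2 ell2_inner ell2 ell2_inner (taylor_op K z w)"
    unfolding bounded_operator_on_def
  proof (intro conjI ballI allI exI)
    fix \<xi> :: "nat \<Rightarrow> 'k ^ 'p" assume \<xi>: "\<xi> \<in> ell2"
    note b = geom_le_ell2[OF D(2)[of \<xi>, OF norm_le_ip_norm_ell2[OF \<xi>]]]
    show "taylor_op K z w \<xi> \<in> ell2" by (rule b)
    show "ip_norm ell2_inner (taylor_op K z w \<xi>) \<le> 2 * D * ip_norm ell2_inner \<xi>"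
      using b(2) by (simp add: mult.assoc)
    show "taylor_op K z w (\<lambda>x. c *s \<xi> x) = (\<lambda>y. c *s taylor_op K z w \<xi> y)" for c
      unfolding taylor_op_def block_op_def vector_scalar_commute
      by (rule ext, rule bounded_linear.suminf[OF bounded_linear_vector_scalar, symmetric]) (rule sm[OF \<xi>])
    show "taylor_op K z w (\<lambda>x. \<xi> x + \<eta> x) = (\<lambda>y. taylor_op K z w \<xi> y + taylor_op K z w \<eta> y)"
      if "\<eta> \<in> ell2" for \<eta>
      unfolding taylor_op_def block_op_def matrix_vector_right_distrib
      by (rule ext, rule suminf_add[symmetric]) (rule sm[OF \<xi>] sm[OF that])+
  qed
  then show ?thesis
    using sm by (simp add: defines_bounded_operator_def taylor_op_def[abs_def])
qed

lemma (in entire_expansion) taylor_op_hermitian: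
  assumes "hermitian_kernel K"
  shows "hermitian_operator_on ell2 ell2_inner (taylor_op K w w)"
  unfolding hermitian_operator_on_def
proof (intro ballI)
  fix \<xi> \<eta> :: "nat \<Rightarrow> 'k ^ 'p" assume "\<xi> \<in> ell2" "\<eta> \<in> ell2"
  note b = norm_le_ip_norm_ell2[OF \<open>\<xi> \<in> ell2\<close>] norm_le_ip_norm_ell2[OF \<open>\<eta> \<in> ell2\<close>]
  have herm: "vinner (K w z *v f) e = cj (vinner (K z w *v e) f)" for z w e f
  proof -
    have "K w z $ i $ j = cj (K z w $ j $ i)" for i j
      using assms by (metis (mono_tags) hermitian_kernel_def conj_transpose_def vec_lambda_beta)
    then have "vinner (K w z *v f) e = (\<Sum>i\<in>UNIV. \<Sum>j\<in>UNIV. cj (K z w $ j $ i) * f $ j * cj (e $ i))"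
      by (simp add: vinner_def matrix_vector_mult_def sum_distrib_right)
    also have "\<dots> = (\<Sum>j\<in>UNIV. \<Sum>i\<in>UNIV. cj (K z w $ j $ i) * f $ j * cj (e $ i))"
      by (rule sum.swap)
    also have "\<dots> = cj (vinner (K z w *v e) f)"
      by (simp add: vinner_def matrix_vector_mult_def sum_distrib_right sum_distrib_left cj_sum cj_mult mult_ac)
    finally show ?thesis .
  qed
  have "ell2_inner \<xi> (taylor_op K w w \<eta>) = (\<Sum>n. cj (vinner (taylor_op K w w \<eta> n) (\<xi> n)))"
    unfolding ell2_inner_def by (simp add: vinner_commute[symmetric])
  also have "\<dots> = cj (ell2_inner (taylor_op K w w \<eta>) \<xi>)"
    unfolding ell2_inner_def
    by (rule bounded_linear.suminf[OF bounded_linear_cj, symmetric])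
       (rule taylor_op_inner(2)[of \<eta> _ \<xi>, OF b(2) b(1)])
  also have "\<dots> = cj (form (cotaylor w \<eta>) (cotaylor w \<xi>))"
    by (simp only: taylor_op_inner(1)[of \<eta> _ \<xi>, OF b(2) b(1)])
  also have "\<dots> = form (cotaylor w \<xi>) (cotaylor w \<eta>)"
    by (rule form_hermitian[OF herm, symmetric])
       (rule geom_growth_cotaylor[of \<eta>, OF b(2)] geom_growth_cotaylor[of \<xi>, OF b(1)])+
  also have "\<dots> = ell2_inner (taylor_op K w w \<xi>) \<eta>"
    by (simp only: taylor_op_inner(1)[of \<xi> _ \<eta>, OF b])
  finally show "ell2_inner (taylor_op K w w \<xi>) \<eta> = ell2_inner \<xi> (taylor_op K w w \<eta>)" by simp
qed

text \<open>
The quadratic sum over finitely many points and vectors is the value of the form on the single sequence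
\<open>\<Psi>\<close> that combines the sequences \<open>cotaylor z \<xi>\<close> with the given weights.
\<close>

lemma (in entire_expansion) taylor_op_positive_definite:
  assumes pd: "positive_definite_matrix_kernel K"
  shows "positive_definite_kernel ell2 ell2_inner (taylor_op K)"
proof -
  have herm: "vinner (K w z *v f) e = cj (vinner (K z w *v e) f)" for z w e f
  proof -
    have "\<forall>x\<in>UNIV \<times> UNIV. \<forall>y\<in>UNIV \<times> UNIV. (\<lambda>(z, f) (w, e). vinner (K z w *v e) f) y x
        = cj ((\<lambda>(z, f) (w, e). vinner (K z w *v e) f) x y)"
      using pd unfolding positive_definite_matrix_kernel_def positive_definite_kernel_def
        psd_scalar_kernel_def by (rule conjunct1)
    from this[rule_format, of "(z, f)" "(w, e)"] show ?thesis by simp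
  qed
  have inner: "ell2_inner (taylor_op K z w \<xi>) \<eta> = form (cotaylor w \<xi>) (cotaylor z \<eta>)"
    if "\<xi> \<in> ell2" "\<eta> \<in> ell2" for z w \<xi> \<eta>
    by (rule taylor_op_inner(1)[of \<xi> _ \<eta>, OF norm_le_ip_norm_ell2[OF that(1)] norm_le_ip_norm_ell2[OF that(2)]])
  have g: "geom_growth (cotaylor w \<xi>)" if "\<xi> \<in> ell2" for w and \<xi> :: "nat \<Rightarrow> 'k ^ 'p"
    by (rule geom_growth_cotaylor[of \<xi>, OF norm_le_ip_norm_ell2[OF that]])
  show ?thesis
    unfolding positive_definite_kernel_def psd_scalar_kernel_def
  proof (intro conjI ballI allI impI)
    fix x y :: "'k \<times> (nat \<Rightarrow> 'k ^ 'p)"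
    assume xy: "x \<in> UNIV \<times> ell2" "y \<in> UNIV \<times> ell2"
    obtain z f w e where [simp]: "x = (z, f)" "y = (w, e)" by (cases x, cases y)
    have "f \<in> ell2" "e \<in> ell2" using xy by auto
    then show "(\<lambda>(z, f) (w, e). ell2_inner (taylor_op K z w e) f) y x
        = cj ((\<lambda>(z, f) (w, e). ell2_inner (taylor_op K z w e) f) x y)"
      using form_hermitian[OF herm, of "cotaylor w e" "cotaylor z f"] by (simp add: inner g)
  next
    fix S :: "('k \<times> (nat \<Rightarrow> 'k ^ 'p)) set" and c
    assume fin: "finite S" and S: "S \<subseteq> UNIV \<times> ell2"
    define T where "T x = cotaylor (fst x) (snd x)" for x :: "'k \<times> (nat \<Rightarrow> 'k ^ 'p)"
    have gT: "geom_growth (T x)" if "x \<in> S" for x using S that by (auto simp: T_def g)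
    define \<Psi> where "\<Psi> = (\<lambda>m. \<Sum>x\<in>S. c x *s T x m)"
    have "(\<Sum>x\<in>S. \<Sum>y\<in>S. cj (c x) * (\<lambda>(z, f) (w, e). ell2_inner (taylor_op K z w e) f) x y * c y)
        = (\<Sum>x\<in>S. \<Sum>y\<in>S. cj (c x) * form (T y) (T x) * c y)"
    proof (intro sum.cong refl)
      fix x y assume "x \<in> S" "y \<in> S"
      then have "snd x \<in> ell2" "snd y \<in> ell2" using S by auto
      then show "cj (c x) * (\<lambda>(z, f) (w, e). ell2_inner (taylor_op K z w e) f) x y * c y
          = cj (c x) * form (T y) (T x) * c y"
        by (simp add: T_def inner case_prod_unfold)
    qed
    also have "\<dots> = form \<Psi> \<Psi>"
      unfolding \<Psi>_def
      by (simp add: form_sum_right form_sum_left form_scale_left form_scale_right geom_growth_sum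
          geom_growth_scale gT sum_distrib_left mult_ac)
    also have "\<dots> \<in> \<real>\<^sub>\<ge>\<^sub>0"
      by (rule form_nonneg[OF pd]) (simp add: \<Psi>_def geom_growth_sum geom_growth_scale gT)
    finally show "(\<Sum>x\<in>S. \<Sum>y\<in>S. cj (c x) * (\<lambda>(z, f) (w, e). ell2_inner (taylor_op K z w e) f) x y * c y)
        \<in> \<real>\<^sub>\<ge>\<^sub>0" .
  qed
qed

section \<open>Hilbert spaces of functions\<close>

locale hilbert_function_space =
  fixes H :: "('x \<Rightarrow> 'k::rc_field ^ 'p) set" and ip :: "('x \<Rightarrow> 'k ^ 'p) \<Rightarrow> ('x \<Rightarrow> 'k ^ 'p) \<Rightarrow> 'k"
  assumes hilbert: "hilbert_space_on H ip"
begin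

lemma zero_mem: "(\<lambda>x. 0) \<in> H"
  and add_mem: "f \<in> H \<Longrightarrow> g \<in> H \<Longrightarrow> (\<lambda>x. f x + g x) \<in> H"
  and scale_mem: "f \<in> H \<Longrightarrow> (\<lambda>x. c *s f x) \<in> H"
  using hilbert unfolding hilbert_space_on_def function_subspace_def by blast+

lemma diff_mem: "f \<in> H \<Longrightarrow> g \<in> H \<Longrightarrow> (\<lambda>x. f x - g x) \<in> H"
  using add_mem[of f "\<lambda>x. (-1) *s g x"] scale_mem[of g "-1"] by simp

lemma sum_mem: "(\<And>j. j \<in> S \<Longrightarrow> f j \<in> H) \<Longrightarrow> (\<lambda>x. \<Sum>j\<in>S. f j x) \<in> H"
  by (induction S rule: infinite_finite_induct) (auto intro: zero_mem add_mem)

lemma ip_add_left: "f \<in> H \<Longrightarrow> g \<in> H \<Longrightarrow> h \<in> H \<Longrightarrow> ip (\<lambda>x. f x + g x) h = ip f h + ip g h"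
  and ip_scale_left: "f \<in> H \<Longrightarrow> h \<in> H \<Longrightarrow> ip (\<lambda>x. c *s f x) h = c * ip f h"
  and ip_commute: "f \<in> H \<Longrightarrow> g \<in> H \<Longrightarrow> ip g f = cj (ip f g)"
  and ip_nonneg: "f \<in> H \<Longrightarrow> ip f f \<in> \<real>\<^sub>\<ge>\<^sub>0"
  and ip_definite: "f \<in> H \<Longrightarrow> ip f f = 0 \<Longrightarrow> f = (\<lambda>x. 0)"
  using hilbert unfolding hilbert_space_on_def inner_product_on_def by blast+

lemma ip_add_right: "f \<in> H \<Longrightarrow> g \<in> H \<Longrightarrow> h \<in> H \<Longrightarrow> ip h (\<lambda>x. f x + g x) = ip h f + ip h g"
  using ip_commute[of "\<lambda>x. f x + g x" h] ip_commute[of f h] ip_commute[of g h]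
  by (simp add: ip_add_left add_mem cj_add)

lemma ip_scale_right: "f \<in> H \<Longrightarrow> h \<in> H \<Longrightarrow> ip h (\<lambda>x. c *s f x) = cj c * ip h f"
  using ip_commute[of "\<lambda>x. c *s f x" h] ip_commute[of f h]
  by (simp add: ip_scale_left scale_mem cj_mult)

lemma ip_diff_left: "f \<in> H \<Longrightarrow> g \<in> H \<Longrightarrow> h \<in> H \<Longrightarrow> ip (\<lambda>x. f x - g x) h = ip f h - ip g h"
  using ip_add_left[of "\<lambda>x. f x - g x" g h] by (simp add: diff_mem)

lemma ip_diff_right: "f \<in> H \<Longrightarrow> g \<in> H \<Longrightarrow> h \<in> H \<Longrightarrow> ip h (\<lambda>x. f x - g x) = ip h f - ip h g"
  using ip_add_right[of "\<lambda>x. f x - g x" g h] by (simp add: diff_mem)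

lemma ip_zero_right: "f \<in> H \<Longrightarrow> ip f (\<lambda>x. 0) = 0"
  using ip_diff_right[of "\<lambda>x. 0" "\<lambda>x. 0" f] by (simp add: zero_mem)

lemma ip_sum_right:
  "(\<And>j. j \<in> S \<Longrightarrow> f j \<in> H) \<Longrightarrow> h \<in> H \<Longrightarrow> ip h (\<lambda>x. \<Sum>j\<in>S. f j x) = (\<Sum>j\<in>S. ip h (f j))"
  by (induction S rule: infinite_finite_induct) (auto simp: ip_zero_right ip_add_right sum_mem)

lemma ip_self: "f \<in> H \<Longrightarrow> ip f f = of_real ((ip_norm ip f)\<^sup>2)"
  using ip_nonneg[of f] by (auto simp: ip_norm_def nonneg_Reals_def)

lemma ip_norm_nonneg: "0 \<le> ip_norm ip f"
  by (simp add: ip_norm_def)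

lemma cauchy_schwarz:
  assumes f: "f \<in> H" and g: "g \<in> H"
  shows "norm (ip f g) \<le> ip_norm ip f * ip_norm ip g"
proof (cases "ip_norm ip g = 0")
  case True
  then have "g = (\<lambda>x. 0)" using ip_self[OF g] ip_definite[OF g] by simp
  then show ?thesis using ip_zero_right[OF f] ip_norm_nonneg by simp
next
  case False
  define b where "b = (ip_norm ip g)\<^sup>2"
  define c where "c = ip f g"
  \<comment> \<open>The component of \<open>f\<close> orthogonal to \<open>g\<close>, multiplied by \<open>b\<close> to avoid division.\<close>
  define h where "h = (\<lambda>x. of_real b *s f x - c *s g x)"
  have bp: "0 < b" using False by (simp add: b_def)
  have hH: "h \<in> H" unfolding h_def using f g by (intro diff_mem scale_mem)
  have "ip h h = of_real b * (of_real b * ip f f - cj c * ip f g) - c * (of_real b * ip g f - cj c * ip g g)"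
    unfolding h_def using f g
    by (simp add: ip_diff_left ip_diff_right ip_scale_left ip_scale_right diff_mem scale_mem cj_of_real algebra_simps)
  also have "\<dots> = of_real b * of_real b * ip f f - of_real b * (c * cj c) - of_real b * (c * cj c)
      + (c * cj c) * of_real b"
    unfolding ip_commute[OF f g] ip_self[OF g] b_def[symmetric] c_def[symmetric]
    by (simp add: algebra_simps)
  also have "\<dots> = of_real (b * (b * (ip_norm ip f)\<^sup>2 - (norm c)\<^sup>2))"
    unfolding ip_self[OF f] mult_cj by (simp add: algebra_simps)
  finally have "of_real ((ip_norm ip h)\<^sup>2) = (of_real (b * (b * (ip_norm ip f)\<^sup>2 - (norm c)\<^sup>2)) :: 'k)"
    unfolding ip_self[OF hH] .
  then have "(ip_norm ip h)\<^sup>2 = b * (b * (ip_norm ip f)\<^sup>2 - (norm c)\<^sup>2)"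
    by (simp only: of_real_eq_iff)
  then have "0 \<le> b * (b * (ip_norm ip f)\<^sup>2 - (norm c)\<^sup>2)" by (metis zero_le_power2)
  then have "(norm c)\<^sup>2 \<le> b * (ip_norm ip f)\<^sup>2"
    using bp by (simp add: zero_le_mult_iff)
  then have "(norm c)\<^sup>2 \<le> (ip_norm ip f * ip_norm ip g)\<^sup>2"
    by (simp add: b_def power_mult_distrib mult.commute)
  then show ?thesis unfolding c_def
    by (rule power2_le_imp_le) (simp add: ip_norm_nonneg)
qed

lemma ip_tendsto_left:
  assumes "\<And>s::nat. F s \<in> H" "f \<in> H" "h \<in> H" and lim: "(\<lambda>s. ip_norm ip (\<lambda>x. F s x - f x)) \<longlonglongrightarrow> 0"
  shows "(\<lambda>s. ip (F s) h) \<longlonglongrightarrow> ip f h"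
proof -
  have "(\<lambda>s. ip_norm ip (\<lambda>x. F s x - f x) * ip_norm ip h) \<longlonglongrightarrow> 0"
    using tendsto_mult_left_zero[OF lim] .
  moreover have "norm (ip (F s) h - ip f h) \<le> ip_norm ip (\<lambda>x. F s x - f x) * ip_norm ip h" for s
    using cauchy_schwarz[OF diff_mem[OF assms(1,2)] assms(3)] by (simp only: ip_diff_left assms(1-3))
  then have "\<forall>\<^sub>F s in sequentially. norm (ip (F s) h - ip f h)
      \<le> ip_norm ip (\<lambda>x. F s x - f x) * ip_norm ip h"
    by (intro always_eventually allI)
  ultimately have "(\<lambda>s. ip (F s) h - ip f h) \<longlonglongrightarrow> 0"
    by (rule Lim_null_comparison[rotated])
  then show ?thesis by (simp add: LIM_zero_iff)
qed

lemma ip_tendsto_right: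
  assumes "\<And>s::nat. F s \<in> H" "f \<in> H" "h \<in> H" and lim: "(\<lambda>s. ip_norm ip (\<lambda>x. F s x - f x)) \<longlonglongrightarrow> 0"
  shows "(\<lambda>s. ip h (F s)) \<longlonglongrightarrow> ip h f"
  using bounded_linear.tendsto[OF bounded_linear_cj ip_tendsto_left[OF assms]]
  by (simp add: ip_commute[symmetric] assms)

lemma complete:
  assumes "\<And>s::nat. F s \<in> H" and "\<And>s t. ip_norm ip (\<lambda>x. F s x - F t x) \<le> \<delta> s + \<delta> t" and "\<delta> \<longlonglongrightarrow> 0"
  obtains f where "f \<in> H" "(\<lambda>s. ip_norm ip (\<lambda>x. F s x - f x)) \<longlonglongrightarrow> 0"
proof -
  have "\<exists>N. \<forall>m\<ge>N. \<forall>n\<ge>N. ip_norm ip (\<lambda>x. F m x - F n x) < \<epsilon>" if "0 < \<epsilon>" for \<epsilon>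
  proof -
    have "\<forall>\<^sub>F s in sequentially. \<delta> s < \<epsilon>/2"
      using order_tendstoD(2)[OF assms(3), of "\<epsilon>/2"] that by simp
    then obtain N where N: "\<And>s. s \<ge> N \<Longrightarrow> \<delta> s < \<epsilon>/2" by (auto simp: eventually_sequentially)
    have "ip_norm ip (\<lambda>x. F m x - F n x) < \<epsilon>" if "m \<ge> N" "n \<ge> N" for m n
      using assms(2)[of m n] N[OF that(1)] N[OF that(2)] by simp
    then show ?thesis by blast
  qed
  moreover have "range F \<subseteq> H" using assms(1) by auto
  ultimately show ?thesis
    using hilbert that unfolding hilbert_space_on_def by blast
qed

end

section \<open>The reproducing kernel Hilbert space\<close>

locale entire_rkhs = entire_expansion A K + hilbert_function_space H ip
  for A and K :: "'k::rc_field \<Rightarrow> 'k \<Rightarrow> 'k ^ 'p ^ 'p" and H ip +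
  assumes kernel_mem: "(\<lambda>z. K z w *v e) \<in> H"
    and reproducing: "f \<in> H \<Longrightarrow> ip f (\<lambda>z. K z w *v e) = vinner (f w) e"
begin

lemma kernel_series_eval_comb_mem: "kernel_series (eval_comb F g) \<in> H"
  unfolding kernel_series_eval_comb[abs_def] by (intro sum_mem kernel_mem)

lemma ip_kernel_series_eval_comb:
  assumes "f \<in> H"
  shows "ip f (kernel_series (eval_comb F g)) = (\<Sum>h\<in>F. vinner (f h) (g h))"
  unfolding kernel_series_eval_comb[abs_def]
  by (simp add: ip_sum_right kernel_mem assms reproducing)

lemma ip_norm_kernel_series_eval_comb:
  "ip_norm ip (kernel_series (eval_comb F g)) = sqrt (norm (form (eval_comb F g) (eval_comb F g)))"
  by (simp add: ip_norm_def ip_kernel_series_eval_comb kernel_series_eval_comb_mem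
      form_eval_comb geom_growth_eval_comb)

text \<open>
On differences of combinations of evaluation sequences the norm of \<open>H\<close> is given by the form, so
approximants of \<open>\<Xi>\<close> are mapped to a Cauchy sequence.  Norm convergence in \<open>H\<close> implies pointwise
convergence, by the reproducing property, and this identifies the limit as \<open>kernel_series \<Xi>\<close>.
\<close>

lemma kernel_series_limit:
  assumes R: "1 \<le> R" and \<Xi>: "geom_le R C \<Xi>"
    and F: "\<And>s. geom_le R (1 / of_nat (Suc s)) (\<lambda>m. \<Xi> m - eval_comb (F s) (g s) m)"
      "\<And>s. finite (F s)"
  shows "kernel_series \<Xi> \<in> H"
    and "(\<lambda>s. ip_norm ip (\<lambda>x. kernel_series (eval_comb (F s) (g s)) x - kernel_series \<Xi> x)) \<longlonglongrightarrow> 0"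
proof -
  define X where "X s = eval_comb (F s) (g s)" for s
  have gX: "geom_growth (X s)" for s unfolding X_def by (rule geom_growth_eval_comb)
  have XH: "kernel_series (X s) \<in> H" for s unfolding X_def by (rule kernel_series_eval_comb_mem)
  have R0: "0 < R" using R by simp
  have g\<Xi>: "geom_growth \<Xi>" using R \<Xi> geom_growthI[of R C \<Xi>] by simp
  have l: "(\<lambda>s. 1 / real (Suc s)) \<longlonglongrightarrow> 0" by (rule LIMSEQ_Suc[OF lim_1_over_n])
  obtain D where D: "0 \<le> D" "\<And>C C' \<Xi> \<Theta>. geom_le R C \<Xi> \<Longrightarrow> geom_le R C' \<Theta> \<Longrightarrow> norm (form \<Xi> \<Theta>) \<le> D * C * C'"
    by (rule form_bound[OF R0]) (rule that; assumption)
  have cauchy: "ip_norm ip (\<lambda>x. kernel_series (X s) x - kernel_series (X t) x)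
      \<le> sqrt D * (1 / real (Suc s)) + sqrt D * (1 / real (Suc t))" for s t
  proof -
    define d where "d = 1 / real (Suc s) + 1 / real (Suc t)"
    obtain G k where G: "\<And>m. X s m - X t m = eval_comb G k m"
      using eval_comb_diff[OF F(2) F(2), of s "g s" t "g t"] by (auto simp: X_def)
    then have GX: "eval_comb G k = (\<lambda>m. X s m - X t m)" by auto
    have "geom_le R (1 / real (Suc t) + 1 / real (Suc s)) (\<lambda>m. (\<Xi> m - X t m) - (\<Xi> m - X s m))"
      unfolding X_def by (rule geom_le_diff[OF F(1) F(1)])
    then have "geom_le R d (eval_comb G k)" unfolding GX d_def by (simp add: add.commute)
    then have "norm (form (eval_comb G k) (eval_comb G k)) \<le> D * d\<^sup>2"
      using D(2)[of d "eval_comb G k" d "eval_comb G k"] by (simp add: power2_eq_square mult.assoc)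
    then have "ip_norm ip (kernel_series (eval_comb G k)) \<le> sqrt (D * d\<^sup>2)"
      unfolding ip_norm_kernel_series_eval_comb by (rule real_sqrt_le_mono)
    also have "\<dots> = sqrt D * d" by (simp add: real_sqrt_mult d_def)
    also have "kernel_series (eval_comb G k) = (\<lambda>x. kernel_series (X s) x - kernel_series (X t) x)"
      unfolding GX by (rule ext) (rule kernel_series_diff[OF gX gX])
    finally show ?thesis by (simp only: d_def distrib_left)
  qed
  have null: "(\<lambda>s. sqrt D * (1 / real (Suc s))) \<longlonglongrightarrow> 0"
    using tendsto_mult_right_zero[OF l] .
  obtain f where f: "f \<in> H" "(\<lambda>s. ip_norm ip (\<lambda>x. kernel_series (X s) x - f x)) \<longlonglongrightarrow> 0"
    by (rule complete[of "\<lambda>s. kernel_series (X s)", OF XH cauchy null]) (rule that; assumption)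
  have "f z = kernel_series \<Xi> z" for z
  proof (rule vinner_eqI)
    fix e :: "'k ^ 'p"
    define ev where "ev = (\<lambda>m. cj z ^ m *s e)"
    \<comment> \<open>The evaluation sequence at \<open>z\<close> may grow faster than \<open>\<Xi>\<close>, so both are measured at a common
      rate.\<close>
    define R' where "R' = max R (norm z)"
    define C' where "C' = max C (norm e)"
    have ev: "geom_le R' C' ev"
      by (rule geom_le_mono[of "norm z" "norm e"])
         (auto simp: R'_def C'_def geom_le_def ev_def norm_power)
    have \<Xi>': "geom_le R' C' \<Xi>"
      by (rule geom_le_mono[OF \<Xi>]) (use R in \<open>auto simp: R'_def C'_def\<close>)
    have X': "geom_le R' (1 / of_nat (Suc s)) (\<lambda>m. \<Xi> m - X s m)" for s
      unfolding X_def by (rule geom_le_mono[OF F(1)]) (use R in \<open>auto simp: R'_def\<close>)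
    have e': "geom_le R' (1 / of_nat (Suc s)) (\<lambda>m. ev m - ev m)" for s
      using R by (auto simp: geom_le_def R'_def)
    have "0 < R'" using R by (simp add: R'_def)
    then have "(\<lambda>s. form (X s) ev) \<longlonglongrightarrow> form \<Xi> ev"
      by (rule form_tendsto[OF _ \<Xi>' ev X' e' l])
    moreover have "form \<Theta> ev = vinner (kernel_series \<Theta> z) e" if "geom_growth \<Theta>" for \<Theta>
      unfolding ev_def by (rule form_eval[OF that])
    ultimately have "(\<lambda>s. vinner (kernel_series (X s) z) e) \<longlonglongrightarrow> vinner (kernel_series \<Xi> z) e"
      using gX g\<Xi> by simp
    moreover have "(\<lambda>s. vinner (kernel_series (X s) z) e) \<longlonglongrightarrow> vinner (f z) e"
      using ip_tendsto_left[OF XH f(1) kernel_mem f(2), of z e] by (simp add: reproducing XH f(1))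
    ultimately show "vinner (f z) e = vinner (kernel_series \<Xi> z) e" using LIMSEQ_unique by blast
  qed
  then have "f = kernel_series \<Xi>" by blast
  then show "kernel_series \<Xi> \<in> H"
    and "(\<lambda>s. ip_norm ip (\<lambda>x. kernel_series (eval_comb (F s) (g s)) x - kernel_series \<Xi> x)) \<longlonglongrightarrow> 0"
    using f by (simp_all add: X_def)
qed

lemma kernel_series_mem:
  assumes "geom_growth \<Xi>"
  shows "kernel_series \<Xi> \<in> H"
proof -
  obtain R C where R: "1 \<le> R" "geom_le R C \<Xi>" using assms by (auto simp: geom_growth_def)
  obtain F g where "\<And>s. finite (F s)"
    "\<And>s. geom_le (2 * R) (1 / of_nat (Suc s)) (\<lambda>m. \<Xi> m - eval_comb (F s) (g s) m)"
    using eval_comb_sequence[OF R(2,1)] by metis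
  moreover have "1 \<le> 2 * R" using R by simp
  moreover have "geom_le (2 * R) C \<Xi>" by (rule geom_le_mono[OF R(2)]) (use R in auto)
  ultimately show ?thesis using kernel_series_limit(1) by blast
qed

lemma ip_kernel_series_kernel_series:
  assumes "geom_growth \<Xi>" "geom_growth \<Theta>"
  shows "ip (kernel_series \<Xi>) (kernel_series \<Theta>) = form \<Xi> \<Theta>"
proof -
  obtain R C where R: "1 \<le> R" "geom_le R C \<Xi>" "geom_le R C \<Theta>"
    using geom_growth_common[OF assms] by metis
  obtain F g where F: "\<And>s. finite (F s)"
    "\<And>s. geom_le (2 * R) (1 / of_nat (Suc s)) (\<lambda>m. \<Theta> m - eval_comb (F s) (g s) m)"
    using eval_comb_sequence[OF R(3,1)] by metis
  have R2: "1 \<le> 2 * R" "0 < 2 * R" using R by auto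
  have b: "geom_le (2 * R) C \<Xi>" "geom_le (2 * R) C \<Theta>"
    using R by (auto intro: geom_le_mono)
  have e: "geom_le (2 * R) (1 / of_nat (Suc s)) (\<lambda>m. \<Xi> m - \<Xi> m)" for s
    using R by (auto simp: geom_le_def)
  have l: "(\<lambda>s. 1 / real (Suc s)) \<longlonglongrightarrow> 0" by (rule LIMSEQ_Suc[OF lim_1_over_n])
  have "(\<lambda>s. ip (kernel_series \<Xi>) (kernel_series (eval_comb (F s) (g s)))) \<longlonglongrightarrow> form \<Xi> \<Theta>"
    using form_tendsto[OF R2(2) b e F(2) l]
    by (simp add: ip_kernel_series_eval_comb form_eval_comb assms kernel_series_mem)
  moreover have "(\<lambda>s. ip (kernel_series \<Xi>) (kernel_series (eval_comb (F s) (g s))))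
      \<longlonglongrightarrow> ip (kernel_series \<Xi>) (kernel_series \<Theta>)"
    using kernel_series_limit(2)[OF R2(1) b(2) F(2,1)]
    by (intro ip_tendsto_right kernel_series_eval_comb_mem kernel_series_mem assms)
  ultimately show ?thesis using LIMSEQ_unique by blast
qed

lemma kernel_series_norm_bound:
  assumes "0 < R"
  obtains D where "0 \<le> D" "\<And>C \<Xi>. geom_le R C \<Xi> \<Longrightarrow> ip_norm ip (kernel_series \<Xi>) \<le> D * C"
proof -
  obtain D where D: "0 \<le> D" "\<And>C C' \<Xi> \<Theta>. geom_le R C \<Xi> \<Longrightarrow> geom_le R C' \<Theta> \<Longrightarrow> norm (form \<Xi> \<Theta>) \<le> D * C * C'"
    by (rule form_bound[OF assms]) (rule that; assumption)
  show ?thesis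
  proof (rule that[of "sqrt D"])
    fix C and \<Xi> :: "nat \<Rightarrow> 'k ^ 'p" assume *: "geom_le R C \<Xi>"
    have g: "geom_growth \<Xi>" using geom_growthI[OF *] assms by simp
    have "ip_norm ip (kernel_series \<Xi>) = sqrt (norm (form \<Xi> \<Xi>))"
      by (simp add: ip_norm_def ip_kernel_series_kernel_series g)
    also have "\<dots> \<le> sqrt (D * C\<^sup>2)"
      using D(2)[OF * *] by (intro real_sqrt_le_mono) (simp add: power2_eq_square mult.assoc)
    also have "\<dots> = sqrt D * C" using geom_le_const_nonneg[OF *] by (simp add: real_sqrt_mult)
    finally show "ip_norm ip (kernel_series \<Xi>) \<le> sqrt D * C" .
  qed (use D in simp)
qed

text \<open>
The power series coefficients at \<open>0\<close> of \<open>f\<close>, shown in \<open>coef_expansion\<close>.  They are defined by pairings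
since no differentiability of the elements of \<open>H\<close> is known beforehand.
\<close>

definition coef :: "('k \<Rightarrow> 'k ^ 'p) \<Rightarrow> nat \<Rightarrow> 'k ^ 'p" where
  "coef f n = (\<chi> i. ip f (kernel_series (unit_seq n (axis i 1))))"

lemma vinner_coef:
  assumes f: "f \<in> H"
  shows "vinner (coef f n) e = ip f (kernel_series (unit_seq n e))"
proof -
  have e: "unit_seq n e = (\<lambda>m. \<Sum>i\<in>UNIV. e $ i *s unit_seq n (axis i 1) m)"
    by (auto simp: unit_seq_def basis_expansion)
  have "kernel_series (unit_seq n e) = (\<lambda>z. \<Sum>i\<in>UNIV. e $ i *s kernel_series (unit_seq n (axis i 1)) z)"
    by (subst e, rule ext)
       (simp add: kernel_series_sum kernel_series_scale geom_growth_scale geom_growth_unit_seq)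
  then have "ip f (kernel_series (unit_seq n e))
      = (\<Sum>i\<in>UNIV. cj (e $ i) * ip f (kernel_series (unit_seq n (axis i 1))))"
    by (simp add: ip_sum_right scale_mem ip_scale_right kernel_series_mem geom_growth_unit_seq f)
  then show ?thesis by (simp add: vinner_def coef_def mult.commute)
qed

text \<open>
In the weighted sup norm for the rate \<open>1/r\<close> the unit sequence at \<open>n\<close> has size \<open>r ^ n\<close>, which bounds the
norm in \<open>H\<close> of the function that it represents.
\<close>

lemma coef_decay:
  assumes r: "0 < r"
  obtains D where "0 \<le> D" "\<And>f. f \<in> H \<Longrightarrow> geom_le r (D * ip_norm ip f) (coef f)"
proof -
  have r': "0 < 1 / r" using r by simp
  obtain D where D: "0 \<le> D" "\<And>C \<Xi>. geom_le (1 / r) C \<Xi> \<Longrightarrow> ip_norm ip (kernel_series \<Xi>) \<le> D * C"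
    by (rule kernel_series_norm_bound[OF r']) (rule that; assumption)
  have u: "geom_le (1 / r) (r ^ n) (unit_seq n (axis i 1 :: 'k ^ 'p))" for n i
    using r by (auto simp: geom_le_def unit_seq_def power_divide norm_axis_one)
  have "norm (coef f n) \<le> of_nat CARD('p) * (ip_norm ip f * (D * r ^ n))" if f: "f \<in> H" for f n
  proof (rule norm_le_card_bound)
    fix i
    have "norm (coef f n $ i) \<le> ip_norm ip f * ip_norm ip (kernel_series (unit_seq n (axis i 1)))"
      unfolding coef_def by (simp add: cauchy_schwarz f kernel_series_mem geom_growth_unit_seq)
    also have "\<dots> \<le> ip_norm ip f * (D * r ^ n)"
      using D(2)[OF u] ip_norm_nonneg by (intro mult_left_mono) auto
    finally show "norm (coef f n $ i) \<le> ip_norm ip f * (D * r ^ n)" .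
  qed
  then show ?thesis
    using D(1) by (intro that[of "of_nat CARD('p) * D"]) (auto simp: geom_le_def mult_ac)
qed

text \<open>
Holds for truncations of \<open>\<Xi>\<close> by linearity, and the truncation error tends to \<open>0\<close> in \<open>H\<close>.
\<close>

lemma ip_kernel_series:
  assumes f: "f \<in> H" and \<Xi>: "geom_growth \<Xi>"
  shows "(\<lambda>n. vinner (coef f n) (\<Xi> n)) sums ip f (kernel_series \<Xi>)"
proof -
  obtain R C where R: "1 \<le> R" "geom_le R C \<Xi>" using \<Xi> by (auto simp: geom_growth_def)
  have R2: "0 < 2 * R" using R by simp
  obtain D where D: "0 \<le> D"
    "\<And>C \<Xi>. geom_le (2 * R) C \<Xi> \<Longrightarrow> ip_norm ip (kernel_series \<Xi>) \<le> D * C"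
    by (rule kernel_series_norm_bound[OF R2]) (rule that; assumption)
  define T where "T M = (\<lambda>m. \<Sum>k<M. unit_seq k (\<Xi> k) m)" for M
  have gT: "geom_growth (T M)" for M
    unfolding T_def by (intro geom_growth_sum geom_growth_unit_seq)
  have "norm (ip f (kernel_series (T M)) - ip f (kernel_series \<Xi>))
      \<le> ip_norm ip f * (D * (C * (1/2) ^ M))" for M
  proof -
    have d: "(\<lambda>z. kernel_series \<Xi> z - kernel_series (T M) z) = kernel_series (\<lambda>m. \<Xi> m - T M m)"
      by (rule ext) (simp add: kernel_series_diff \<Xi> gT)
    have "norm (ip f (kernel_series (T M)) - ip f (kernel_series \<Xi>))
        = norm (ip f (kernel_series (\<lambda>m. \<Xi> m - T M m)))"
      by (simp only: d[symmetric] ip_diff_right kernel_series_mem \<Xi> gT f norm_minus_commute)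
    also have "\<dots> \<le> ip_norm ip f * ip_norm ip (kernel_series (\<lambda>m. \<Xi> m - T M m))"
      by (intro cauchy_schwarz f kernel_series_mem geom_growth_diff \<Xi> gT)
    also have "\<dots> \<le> ip_norm ip f * (D * (C * (1/2) ^ M))"
      using R unfolding T_def by (intro mult_left_mono D truncation_error ip_norm_nonneg) auto
    finally show ?thesis .
  qed
  then have "\<forall>\<^sub>F M in sequentially. norm (ip f (kernel_series (T M)) - ip f (kernel_series \<Xi>))
      \<le> ip_norm ip f * (D * (C * (1/2) ^ M))"
    by (intro always_eventually allI)
  moreover have "(\<lambda>M. ip_norm ip f * (D * (C * (1/2) ^ M))) \<longlonglongrightarrow> 0"
    by (intro tendsto_mult_right_zero LIMSEQ_power_zero) simp
  ultimately have "(\<lambda>M. ip f (kernel_series (T M)) - ip f (kernel_series \<Xi>)) \<longlonglongrightarrow> 0"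
    by (rule Lim_null_comparison)
  then have lim: "(\<lambda>M. ip f (kernel_series (T M))) \<longlonglongrightarrow> ip f (kernel_series \<Xi>)"
    by (simp add: LIM_zero_iff)
  have "kernel_series (T M) = (\<lambda>z. \<Sum>k<M. kernel_series (unit_seq k (\<Xi> k)) z)" for M
    unfolding T_def by (rule ext, rule kernel_series_sum) (rule geom_growth_unit_seq)
  then have "ip f (kernel_series (T M)) = (\<Sum>k<M. vinner (coef f k) (\<Xi> k))" for M
    by (simp add: ip_sum_right f kernel_series_mem geom_growth_unit_seq vinner_coef)
  then show ?thesis using lim by (simp add: sums_def)
qed

text \<open>
The reproducing property is \<open>ip_kernel_series\<close> for an evaluation sequence.
\<close>

lemma coef_expansion:
  assumes f: "f \<in> H"
  shows "(\<lambda>n. coef f n $ i * z ^ n) sums f z $ i"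
proof -
  have "(\<lambda>n. vinner (coef f n) (cj z ^ n *s axis i 1)) sums ip f (kernel_series (\<lambda>m. cj z ^ m *s axis i 1))"
    by (rule ip_kernel_series[OF f geom_growth_eval])
  moreover have "kernel_series (\<lambda>m. cj z ^ m *s axis i 1) = (\<lambda>u. K u z *v axis i 1)"
    by (rule ext) (rule kernel_series_eval)
  ultimately show ?thesis
    by (simp add: vinner_scale_right cj_power vinner_axis reproducing f mult.commute)
qed

lemma taylor_map_nth:
  assumes "f \<in> H"
  shows "taylor_map z f n $ i = taylor_shift z (\<lambda>N. coef f N $ i) n"
  unfolding taylor_map_def
  using deriv_funpow_eq_taylor_shift(1)[OF coef_expansion[OF assms]] by simp

lemma taylor_map_bounded: "bounded_operator_on H ip ell2 ell2_inner (taylor_map z)"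
proof -
  obtain D where D: "0 \<le> D" "\<And>f. f \<in> H \<Longrightarrow> geom_le (1/4 / (1 + norm z)) (D * ip_norm ip f) (coef f)"
    by (rule coef_decay[OF quarter_radius_pos[of z]]) (rule that; assumption)
  have sm: "summable (\<lambda>k. of_nat ((n + k) choose n) * z ^ k * coef f (n + k) $ i)" if "f \<in> H" for f n i
    by (rule deriv_funpow_eq_taylor_shift(2)[OF coef_expansion[OF that]])
  show ?thesis
    unfolding bounded_operator_on_def
  proof (intro conjI ballI allI exI)
    fix f assume f: "f \<in> H"
    note b = geom_le_ell2[OF vector_taylor_shift_bound[OF D(2)[OF f] taylor_map_nth[OF f]]]
    show "taylor_map z f \<in> ell2" by (rule b)
    show "ip_norm ell2_inner (taylor_map z f) \<le> 2 * (of_nat CARD('p) * (2 * D)) * ip_norm ip f"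
      using b(2) by (simp add: mult_ac)
    show "taylor_map z (\<lambda>x. c *s f x) = (\<lambda>y. c *s taylor_map z f y)" for c
      using suminf_mult[OF sm[OF f], of c]
      by (simp add: fun_eq_iff vec_eq_iff taylor_map_nth f scale_mem taylor_shift_def coef_def
          ip_scale_left kernel_series_mem geom_growth_unit_seq mult_ac)
    show "taylor_map z (\<lambda>x. f x + g x) = (\<lambda>y. taylor_map z f y + taylor_map z g y)" if g: "g \<in> H" for g
      using suminf_add[OF sm[OF f] sm[OF g]]
      by (simp add: fun_eq_iff vec_eq_iff taylor_map_nth f g add_mem taylor_shift_def coef_def
          ip_add_left kernel_series_mem geom_growth_unit_seq distrib_left)
  qed
qed

text \<open>
The Taylor map re-expands the coefficients of \<open>f\<close> around \<open>w\<close>; moving this to \<open>\<xi>\<close> leaves the pairing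
of \<open>coef f\<close> with \<open>cotaylor w \<xi>\<close>, which is an inner product in \<open>H\<close>.
\<close>

lemma adjoint_taylor_map:
  assumes "\<xi> \<in> ell2"
  shows "adjoint_on H ip ell2_inner (taylor_map w) \<xi> = kernel_series (cotaylor w \<xi>)"
proof -
  note b = norm_le_ip_norm_ell2[OF assms]
  have g: "geom_growth (cotaylor w \<xi>)" by (rule geom_growth_cotaylor[of \<xi>, OF b])
  obtain D where D: "\<And>f. f \<in> H \<Longrightarrow> geom_le (1/4 / (1 + norm w)) (D * ip_norm ip f) (coef f)"
    by (rule coef_decay[OF quarter_radius_pos[of w]]) (rule that; assumption)
  have adj: "ell2_inner (taylor_map w f) \<xi> = ip f (kernel_series (cotaylor w \<xi>))" if f: "f \<in> H" for f
    using vector_taylor_adjoint(1)[of w _ "coef f" \<xi>, OF D[OF f] b taylor_map_nth[OF f]]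
      ip_kernel_series[OF f g]
    by (simp add: ell2_inner_def[of "coef f"] sums_iff)
  show ?thesis
    unfolding adjoint_on_def
  proof (rule the_equality)
    show "kernel_series (cotaylor w \<xi>) \<in> H \<and>
        (\<forall>f\<in>H. ell2_inner (taylor_map w f) \<xi> = ip f (kernel_series (cotaylor w \<xi>)))"
      using adj kernel_series_mem[OF g] by blast
    fix u assume u: "u \<in> H \<and> (\<forall>f\<in>H. ell2_inner (taylor_map w f) \<xi> = ip f u)"
    define d where "d = (\<lambda>x. u x - kernel_series (cotaylor w \<xi>) x)"
    have d: "d \<in> H" unfolding d_def using u kernel_series_mem[OF g] by (intro diff_mem) auto
    have "ip d d = ip d u - ip d (kernel_series (cotaylor w \<xi>))"
      by (subst (2) d_def) (simp add: ip_diff_right u kernel_series_mem[OF g] d)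
    also have "\<dots> = 0" using u d adj by auto
    finally have "d = (\<lambda>x. 0)" by (rule ip_definite[OF d])
    then show "u = kernel_series (cotaylor w \<xi>)" by (simp add: d_def fun_eq_iff)
  qed
qed

lemma taylor_op_factorization:
  assumes "\<xi> \<in> ell2"
  shows "taylor_op K z w \<xi> = taylor_map z (adjoint_on H ip ell2_inner (taylor_map w) \<xi>)"
proof -
  note b = norm_le_ip_norm_ell2[OF assms]
  have g: "geom_growth (cotaylor w \<xi>)" by (rule geom_growth_cotaylor[of \<xi>, OF b])
  have "taylor_map z (kernel_series (cotaylor w \<xi>)) n $ i = taylor_op K z w \<xi> n $ i" for n i
    unfolding taylor_map_def taylor_op_factor(2)[of \<xi>, OF b]
    using deriv_funpow_eq_taylor_shift(1)[OF kernel_series_nth_sums[OF g]] by simp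
  then show ?thesis by (simp add: adjoint_taylor_map[OF assms] fun_eq_iff vec_eq_iff)
qed

end

theorem theorem3p2:
  fixes K :: "'k::rc_field \<Rightarrow> 'k \<Rightarrow> 'k ^ 'p::finite ^ 'p"
  assumes "entire_kernel K"
  shows
    "(\<forall>z w. defines_bounded_operator (taylor_block K z w)) \<and>
     (hermitian_kernel K \<longrightarrow>
        (\<forall>w. hermitian_operator_on ell2 ell2_inner (taylor_op K w w))) \<and>
     (positive_definite_matrix_kernel K \<longrightarrow>
        positive_definite_kernel ell2 ell2_inner (taylor_op K)) \<and>
     (positive_definite_matrix_kernel K \<longrightarrow>
        (\<forall>H ip. is_rkhs K H ip \<longrightarrow>
           (\<forall>z. bounded_operator_on H ip ell2 ell2_inner (taylor_map z)) \<and>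
           (\<forall>z w. \<forall>\<xi>\<in>ell2.
              taylor_op K z w \<xi> = taylor_map z (adjoint_on H ip ell2_inner (taylor_map w) \<xi>))))"
proof -
  obtain A where "entire_expansion A K"
    using assms unfolding entire_kernel_def entire_expansion_def by blast
  then interpret entire_expansion A K .
  have "entire_rkhs A K H ip" if "is_rkhs K H ip" for H ip
    using that by unfold_locales (auto simp: is_rkhs_def)
  then show ?thesis
    using taylor_block_bounded taylor_op_hermitian taylor_op_positive_definite
      entire_rkhs.taylor_map_bounded entire_rkhs.taylor_op_factorization by blast
qed

end
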